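(* Let $s$ be a natural number, $r$ an even natural number with $6 \leq r \leq s$, and $b$ a real number with $b \leq s$. Let \[ \psi^b_{s,r} := r - 4 - 4\pi(b), \] \[ \kappa^b_{s,r} := 2\left(\ln \frac{(2s-3r/2+2)!\, s!}{(2s-r+2)!\,(s-r+1)!\,(s-r/2+1)} + (s-r)\ln 2\right) + 2\sum_{\text{prime } p,\ b < p \leq s} \mathrm{val}_p(\tilde{F}_{s,r})\ln p + \left(4 \ln \tfrac{3}{2}\right)\pi(b), \] where $\tilde{F}_{s,r} := s!\,r!\,\ell_{s-1}^2\,\ell_{s-2}^2\,(s-r+1)!\,(s-r/2+1)$. Suppose $\psi^b_{s,r} > 0$. If a nontrivial tight $2s$-$(v,k,\lambda)$ design exists, then $v - 2s + 1 \leq \exp(\kappa^b_{s,r}/\psi^b_{s,r})$.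
   Context: A $t$-$(v,k,\lambda)$ design is a $v$-set $V$ with a collection $B$ of $k$-subsets (blocks) such that every $t$-subset of $V$ lies in exactly $\lambda$ blocks; it is nontrivial if $B$ is not the set of all $k$-subsets of $V$; a $2s$-design is tight if $|B| = \binom{v}{s}$. $\pi(x)$ is the number of primes $\leq x$. For a natural number $n$, $\ell_n := \mathrm{lcm}\{\binom{i}{j} : 0 \leq j \leq i \leq n\}$. $\mathrm{val}_p$ is the $p$-adic valuation.
   Formalization: Designs are required to have λ > 0; with λ = 0 and k < 2s allowed, any C(v,s) of the k-subsets (e.g. s = r = 6, b = 1, k = 7, v large) would be a nontrivial tight design with v unbounded, and the claim would fail. *)

theory Defs
  imports Complex_Main "HOL-Computational_Algebra.Primes"
begin

text \<open>
  A t-(v,k,lam) design with point set V and block set B (no repeated blocks). As usual, lam is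
  positive. This is needed: if lam = 0 and k < t were allowed, any family of k-subsets would be a
  design, and tight nontrivial such families exist on arbitrarily many points.
\<close>
definition design :: "nat \<Rightarrow> nat \<Rightarrow> nat \<Rightarrow> nat \<Rightarrow> 'a set \<Rightarrow> 'a set set \<Rightarrow> bool" where
  "design t v k lam V B \<longleftrightarrow>
     finite V \<and> card V = v \<and> 0 < lam \<and>
     B \<subseteq> {X. X \<subseteq> V \<and> card X = k} \<and>
     (\<forall>T. T \<subseteq> V \<and> card T = t \<longrightarrow> card {X \<in> B. T \<subseteq> X} = lam)"

definition nontrivial_design :: "nat \<Rightarrow> nat \<Rightarrow> nat \<Rightarrow> nat \<Rightarrow> 'a set \<Rightarrow> 'a set set \<Rightarrow> bool" where
  "nontrivial_design t v k lam V B \<longleftrightarrow>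
     design t v k lam V B \<and> B \<noteq> {X. X \<subseteq> V \<and> card X = k}"

definition tight_design :: "nat \<Rightarrow> nat \<Rightarrow> nat \<Rightarrow> nat \<Rightarrow> 'a set \<Rightarrow> 'a set set \<Rightarrow> bool" where
  "tight_design s v k lam V B \<longleftrightarrow> design (2 * s) v k lam V B \<and> card B = v choose s"

definition prime_pi :: "real \<Rightarrow> nat" where
  "prime_pi x = card {p::nat. prime p \<and> real p \<le> x}"

definition ell :: "nat \<Rightarrow> nat" where
  "ell n = Lcm {i choose j | i j. j \<le> i \<and> i \<le> n}"

text \<open>
  The functions below are only meaningful for even r with 6 \<le> r \<le> s; in that range all
  subtractions on naturals are exact and r div 2, 3 * r div 2 are the true quotients.
\<close>

definition F_tilde :: "nat \<Rightarrow> nat \<Rightarrow> nat" where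
  "F_tilde s r =
     fact s * fact r * (ell (s - 1))\<^sup>2 * (ell (s - 2))\<^sup>2 * fact (s - r + 1) * (s - r div 2 + 1)"

definition psi :: "real \<Rightarrow> nat \<Rightarrow> nat \<Rightarrow> real" where
  "psi b s r = real r - 4 - 4 * real (prime_pi b)"

definition kappa :: "real \<Rightarrow> nat \<Rightarrow> nat \<Rightarrow> real" where
  "kappa b s r =
     2 * (ln (fact (2 * s - 3 * r div 2 + 2) * fact s /
              (fact (2 * s - r + 2) * fact (s - r + 1) * real (s - r div 2 + 1)))
          + real (s - r) * ln 2)
     + 2 * (\<Sum>p \<in> {p::nat. prime p \<and> b < real p \<and> p \<le> s}.
              real (multiplicity p (F_tilde s r)) * ln (real p))
     + (4 * ln (3 / 2)) * real (prime_pi b)"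

end

theory Submission
  imports Defs "HOL-Computational_Algebra.Polynomial"
begin

text \<open>
  Put \<open>a = k - s\<close>, \<open>b = v - k - s\<close>, \<open>m = a + b = v - 2 s\<close> and \<open>r = 2 q\<close>. The block
  intersection numbers of a tight design are the zeros of a polynomial of degree \<open>s\<close>, so that
  its normalised coefficients are integers: the product of \<open>m + 1, \<dots>, m + j\<close> divides \<open>s choose j\<close>
  times the product of \<open>a + 1, \<dots>, a + j\<close> and \<open>b + 1, \<dots>, b + j\<close>. Also, the number of blocks
  through \<open>t \<le> 2 s\<close> points is an integer. If a prime power \<open>p\<^sup>e\<close> divides \<open>m + i\<close>, these two
  conditions force it, up to a small error which vanishes for \<open>p > s\<close>, to divide \<open>a + l\<close> and
  \<open>b + (i - l)\<close> for some \<open>l \<le> i\<close>. Hence the fraction with numerator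
  \<open>\<Prod>l<q. (a + l) (b + l)\<close> and denominator \<open>\<Prod>i<q - 1. (m + 1 + i)\<close> times
  \<open>\<Prod>i<2 q - 1. (m + 1 + i)\<close> is almost an integer, although it has size about \<open>4\<^sup>-\<^sup>q (m + 1)\<^sup>2\<^sup>-\<^sup>q\<close>.
  Bounding its denominator by the two largest factors at the primes \<open>p \<le> beta\<close>, where
  \<open>beta\<close> is the real parameter called \<open>b\<close> in the theorem, and at the primes \<open>beta < p \<le> s\<close> by \<open>F_tilde s r\<close> gives the theorem.
\<close>

section \<open>Valuations of products of consecutive integers\<close>

text \<open>The exponents explain the shape of \<open>psi\<close>. Were nothing lost at any prime,
  \<open>num\<close> / \<open>den\<close> would be a positive integer, against its size; primes p >
  s indeed lose nothing. At each prime p \<le> beta the two factors given up are at most 3/2 (m +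
  1), which lowers the usable exponent q - 2 by 2 pi(beta). Doubling the resulting inequality gives
  r - 4 - 4 pi(beta) on one side and the term 4 ln (3/2) pi(beta) on the other. The delicate point
  is the accounting for beta < p \<le> s. The errors are valuations of binomial coefficients, hence
  bounded by logarithms to base p, and \<open>F_tilde\<close> covers them except that one factor p
  may be missing when p is s - 1 or s. This can happen for one prime only, so the total excess is at
  most s, and slack in the factorial term of \<open>kappa\<close> absorbs it. When s = 2 q that
  slack can be too small, but then the excess does not occur; the case distinction 2 q < s runs
  through the proof for this reason.\<close>

lemma interval_prod: "\<Prod>{Suc x..x + n} = fact n * ((x + n) choose n)" for x n :: nat
proof -
  have "fact (x + n) = (fact x :: nat) * \<Prod>{Suc x..x + n}"
    by (rule fact_eq_fact_times) simp
  moreover have "fact n * fact x * ((x + n) choose n) = (fact (x + n) :: nat)"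
    using binomial_fact_lemma[of n "x + n"] by simp
  ultimately have "fact x * \<Prod>{Suc x..x + n} = fact x * (fact n * ((x + n) choose n))"
    by (simp add: mult_ac)
  then show ?thesis by (simp only: mult_cancel_left fact_nonzero) simp
qed

lemma interval_prod_pos: "0 < \<Prod>{Suc x..y}" for x y :: nat
  by (rule prod_pos) auto

context
  fixes p :: nat
  assumes p: "prime p"
begin

lemma val_mult:
  "x > 0 \<Longrightarrow> y > 0 \<Longrightarrow> multiplicity p (x * y) = multiplicity p x + multiplicity p (y :: nat)"
  using p by (simp add: prime_elem_multiplicity_mult_distrib)

lemma val_dvd: "x dvd y \<Longrightarrow> y > 0 \<Longrightarrow> multiplicity p x \<le> multiplicity p (y :: nat)"
  by (rule dvd_imp_multiplicity_le) auto

lemma val_prod_mono: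
  assumes "finite A" "\<And>x. x \<in> A \<Longrightarrow> f x > 0 \<and> g x > 0"
    and "\<And>x. x \<in> A \<Longrightarrow> multiplicity p (f x) \<le> multiplicity p (g x :: nat)"
  shows "multiplicity p (prod f A :: nat) \<le> multiplicity p (prod g A)"
  using assms
proof (induction A rule: finite_induct)
  case (insert x A)
  have "prod f A > 0" "prod g A > 0"
    using insert.prems by (auto intro!: prod_pos)
  then show ?case
    using insert by (simp add: val_mult add_mono)
qed simp

lemma pow_val_le: "x > 0 \<Longrightarrow> p ^ multiplicity p x \<le> (x :: nat)"
  by (rule dvd_imp_le[OF multiplicity_dvd]) auto

lemma val_ge: "p ^ e dvd x \<Longrightarrow> x > 0 \<Longrightarrow> e \<le> multiplicity p (x :: nat)"
  using p by (intro multiplicity_geI) auto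

lemma val_le_diff:
  assumes "multiplicity p x \<le> multiplicity p y" "0 < x" "x < y"
  shows "multiplicity p x \<le> multiplicity p (y - x :: nat)"
proof (rule val_ge)
  have "p ^ multiplicity p x dvd y"
    using assms(1) multiplicity_dvd' by blast
  then show "p ^ multiplicity p x dvd y - x"
    by (simp add: multiplicity_dvd dvd_diff_nat)
qed (use assms in auto)

lemma val_diff_eq:
  assumes "multiplicity p x < multiplicity p y" "0 < x" "0 < y"
  shows "x < y \<Longrightarrow> multiplicity p (y - x) = multiplicity p (x :: nat)"
    and "y < x \<Longrightarrow> multiplicity p (x - y) = multiplicity p (x :: nat)"
proof -
  show "multiplicity p (y - x) = multiplicity p x" if "x < y"
  proof (rule antisym)
    show "multiplicity p x \<le> multiplicity p (y - x)"
      using val_le_diff assms that by simp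
    show "multiplicity p (y - x) \<le> multiplicity p x"
    proof (rule ccontr)
      assume "\<not> ?thesis"
      then have "p ^ Suc (multiplicity p x) dvd y - x" "p ^ Suc (multiplicity p x) dvd y"
        using assms by (auto intro!: multiplicity_dvd' simp del: power_Suc)
      then have "p ^ Suc (multiplicity p x) dvd y - (y - x)"
        using dvd_diff_nat by blast
      then have "Suc (multiplicity p x) \<le> multiplicity p x"
        using that assms by (intro val_ge) auto
      then show False by simp
    qed
  qed
  show "multiplicity p (x - y) = multiplicity p x" if "y < x"
  proof (rule antisym)
    have "p ^ multiplicity p x dvd x - y"
      using assms by (intro dvd_diff_nat multiplicity_dvd multiplicity_dvd') auto
    then show "multiplicity p x \<le> multiplicity p (x - y)"
      using that by (intro val_ge) auto
    show "multiplicity p (x - y) \<le> multiplicity p x"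
    proof (rule ccontr)
      assume "\<not> ?thesis"
      then have "p ^ Suc (multiplicity p x) dvd x - y" "p ^ Suc (multiplicity p x) dvd y"
        using assms by (auto intro!: multiplicity_dvd' simp del: power_Suc)
      then have "p ^ Suc (multiplicity p x) dvd (x - y) + y"
        using dvd_add by blast
      then have "Suc (multiplicity p x) \<le> multiplicity p x"
        using that assms by (intro val_ge) auto
      then show False by simp
    qed
  qed
qed

lemma val_fact_le: "n \<le> k \<Longrightarrow> multiplicity p (fact n :: nat) \<le> multiplicity p (fact k :: nat)"
  by (intro val_dvd fact_dvd) auto

lemma val_fact_binomial:
  assumes "k \<le> n"
  shows "multiplicity p (fact n :: nat)
           = multiplicity p (n choose k) + multiplicity p (fact k :: nat) + multiplicity p (fact (n - k) :: nat)"
proof -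
  have "fact n = (n choose k) * (fact k * (fact (n - k) :: nat))"
    using binomial_fact_lemma[OF assms] by (simp add: mult_ac)
  then show ?thesis
    using assms by (simp add: val_mult)
qed

lemma val_prod_ge_fact: "multiplicity p (fact n :: nat) \<le> multiplicity p (\<Prod>{Suc x..x + n})"
  by (intro val_dvd interval_prod_pos) (simp only: interval_prod, simp)

lemma interval_split:
  assumes "y \<in> {Suc x..x + n :: nat}"
  shows "\<Prod>{Suc x..x + n} = \<Prod>{Suc x..<y} * (y * \<Prod>{Suc y..x + n})"
proof -
  have "{Suc x..x + n} = {Suc x..<y} \<union> {y} \<union> {Suc y..x + n}"
    using assms by auto
  moreover have "\<Prod>({Suc x..<y} \<union> {y} \<union> {Suc y..x + n}) = \<Prod>{Suc x..<y} * y * \<Prod>{Suc y..x + n}"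
    by (subst prod.union_disjoint; (subst prod.union_disjoint)?) auto
  ultimately show ?thesis by (simp add: mult_ac)
qed

text \<open>The factors below \<open>y\<close> and those above \<open>y\<close> are two runs of
  consecutive integers, each divisible by the factorial of its length.\<close>

lemma val_prod_ge:
  assumes "y \<in> {Suc x..x + n}"
  shows "multiplicity p y + multiplicity p (fact (y - Suc x) :: nat) + multiplicity p (fact (x + n - y) :: nat)
           \<le> multiplicity p (\<Prod>{Suc x..x + n})"
proof -
  have 1: "{Suc x..<y} = {Suc x..x + (y - Suc x)}" and 2: "{Suc y..x + n} = {Suc y..y + (x + n - y)}"
    using assms by auto
  have "multiplicity p (fact (y - Suc x) :: nat) \<le> multiplicity p (\<Prod>{Suc x..<y})"
    unfolding 1 by (rule val_prod_ge_fact)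
  moreover have "multiplicity p (fact (x + n - y) :: nat) \<le> multiplicity p (\<Prod>{Suc y..x + n})"
    by (subst 2) (rule val_prod_ge_fact)
  moreover have "\<Prod>{Suc x..<y} > 0" by (rule prod_pos) auto
  then have "multiplicity p (\<Prod>{Suc x..x + n})
      = multiplicity p (\<Prod>{Suc x..<y}) + (multiplicity p y + multiplicity p (\<Prod>{Suc y..x + n}))"
    unfolding interval_split[OF assms] using assms by (simp add: val_mult interval_prod_pos)
  ultimately show ?thesis by linarith
qed

text \<open>Single out a factor \<open>y\<close> of largest valuation. The valuation of any other
  factor is at most that of its distance to \<open>y\<close>, and the distances on the two sides
  multiply to two factorials whose product divides (n - 1)!. So all factors but one cost no more
  than a factorial.\<close>

lemma val_prod_le:
  assumes "n > 0" and le: "\<And>y. y \<in> {Suc x..x + n} \<Longrightarrow> multiplicity p y \<le> E"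
  shows "multiplicity p (\<Prod>{Suc x..x + n}) \<le> E + multiplicity p (fact (n - 1) :: nat)"
proof -
  define I where "I = {Suc x..x + n}"
  have "finite I" "I \<noteq> {}" using assms(1) by (auto simp: I_def)
  then have "Max (multiplicity p ` I) \<in> multiplicity p ` I"
    by (intro Max_in) auto
  then obtain y where y: "y \<in> I" "multiplicity p y = Max (multiplicity p ` I)"
    by (metis imageE)
  have max: "multiplicity p z \<le> multiplicity p y" if "z \<in> I" for z
    unfolding y(2) using that \<open>finite I\<close> by auto
  have yI: "y \<in> {Suc x..x + n}" using y I_def by simp
  have "multiplicity p (\<Prod>{Suc x..<y}) \<le> multiplicity p (\<Prod>z\<in>{Suc x..<y}. y - z)"
    using yI max by (intro val_prod_mono) (auto intro!: val_le_diff simp: I_def)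
  also have "(\<Prod>z\<in>{Suc x..<y}. y - z) = fact (y - Suc x)"
  proof -
    have "(\<Prod>z\<in>{Suc x..<y}. y - z) = \<Prod>{1..y - Suc x}"
      using yI by (intro prod.reindex_bij_witness[where i = "\<lambda>j. y - j" and j = "\<lambda>z. y - z"]) auto
    then show ?thesis by (simp add: fact_prod)
  qed
  finally have A: "multiplicity p (\<Prod>{Suc x..<y}) \<le> multiplicity p (fact (y - Suc x) :: nat)" .
  have "multiplicity p (\<Prod>{Suc y..x + n}) \<le> multiplicity p (\<Prod>z\<in>{Suc y..x + n}. z - y)"
  proof (intro val_prod_mono)
    fix z assume z: "z \<in> {Suc y..x + n}"
    have "p ^ multiplicity p z dvd z - y"
      using z yI max by (intro dvd_diff_nat multiplicity_dvd multiplicity_dvd') (auto simp: I_def)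
    then show "multiplicity p z \<le> multiplicity p (z - y)"
      using z by (intro val_ge) auto
  qed auto
  also have "(\<Prod>z\<in>{Suc y..x + n}. z - y) = fact (x + n - y)"
  proof -
    have "(\<Prod>z\<in>{Suc y..x + n}. z - y) = \<Prod>{1..x + n - y}"
      using yI by (intro prod.reindex_bij_witness[where i = "\<lambda>j. y + j" and j = "\<lambda>z. z - y"]) auto
    then show ?thesis by (simp add: fact_prod)
  qed
  finally have B: "multiplicity p (\<Prod>{Suc y..x + n}) \<le> multiplicity p (fact (x + n - y) :: nat)" .
  have C: "multiplicity p (fact (n - 1) :: nat) \<ge> multiplicity p (fact (y - Suc x) :: nat)
             + multiplicity p (fact (x + n - y) :: nat)"
  proof -
    have "n - 1 - (y - Suc x) = x + n - y" "y - Suc x \<le> n - 1" using yI by auto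
    then show ?thesis using val_fact_binomial[of "y - Suc x" "n - 1"] by simp
  qed
  have "\<Prod>{Suc x..<y} > 0" by (rule prod_pos) auto
  then have "multiplicity p (\<Prod>{Suc x..x + n})
      = multiplicity p (\<Prod>{Suc x..<y}) + (multiplicity p y + multiplicity p (\<Prod>{Suc y..x + n}))"
    unfolding interval_split[OF yI] using yI by (simp add: val_mult interval_prod_pos)
  then show ?thesis using A B C le[OF yI] by linarith
qed

text \<open>In the numerator, \<open>val_prod_le\<close> leaves a single factor y \<le> n on top of
  (k - 1)!, and the denominator k! cancels the latter.\<close>

lemma pow_val_binomial_le:
  assumes "k \<le> n" "0 < n"
  shows "p ^ multiplicity p (n choose k) \<le> n"
proof (cases "k = 0")
  case False
  define x where "x = n - k"
  have n: "n = x + k" using assms x_def by simp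
  define E where "E = Max (multiplicity p ` {Suc x..x + k})"
  have "E \<in> multiplicity p ` {Suc x..x + k}"
    unfolding E_def using False by (intro Max_in) auto
  then obtain y where y: "y \<in> {Suc x..x + k}" "E = multiplicity p y" by blast
  have "multiplicity p (\<Prod>{Suc x..x + k}) \<le> E + multiplicity p (fact (k - 1) :: nat)"
    using False by (intro val_prod_le) (auto simp: E_def)
  moreover have "multiplicity p (\<Prod>{Suc x..x + k})
      = multiplicity p (fact k :: nat) + multiplicity p (n choose k)"
    unfolding interval_prod using assms n by (simp add: val_mult)
  ultimately have "multiplicity p (n choose k) \<le> E"
    using val_fact_le[of "k - 1" k] by linarith
  then have "p ^ multiplicity p (n choose k) \<le> p ^ E"
    using p prime_gt_0_nat by (intro power_increasing) (auto simp: Suc_leI)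
  also have "\<dots> \<le> y" unfolding y(2) using y by (intro pow_val_le) auto
  finally show ?thesis using y n by simp
qed (use assms in auto)

end

section \<open>Prime powers dividing \<open>ell\<close>\<close>

lemma dvd_ell: "j \<le> i \<Longrightarrow> i \<le> n \<Longrightarrow> (i choose j) dvd ell n"
  unfolding ell_def by (rule dvd_Lcm) blast

lemma ell_pos: "ell n > 0"
proof -
  have "{i choose j |i j. j \<le> i \<and> i \<le> n} = (\<lambda>(i, j). i choose j) ` {(i, j). j \<le> i \<and> i \<le> n}"
    by auto
  moreover have "{(i, j). j \<le> i \<and> i \<le> n} \<subseteq> {..n} \<times> {..n}" by auto
  then have "finite {(i, j). j \<le> i \<and> i \<le> n}" by (rule finite_subset) simp
  ultimately have "finite {i choose j |i j. j \<le> i \<and> i \<le> n}" by simp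
  then have "Lcm {i choose j |i j. j \<le> i \<and> i \<le> n} \<noteq> 0"
    by (subst Lcm_0_iff) (auto simp: binomial_eq_0_iff)
  then show ?thesis unfolding ell_def by simp
qed

text \<open>Lower index 1 puts every positive number up to n among the binomial coefficients, in
  particular the prime power itself.\<close>

lemma le_val_ell:
  assumes "prime p" "p ^ e \<le> n"
  shows "e \<le> multiplicity p (ell n)"
proof (rule val_ge[OF assms(1) _ ell_pos])
  have "(p ^ e choose 1) dvd ell n"
    using assms prime_gt_0_nat by (intro dvd_ell) (auto simp: Suc_leI)
  then show "p ^ e dvd ell n" by simp
qed

lemma val_binomial_le_ell:
  assumes "prime p" "j \<le> i" "i \<le> n"
  shows "multiplicity p (i choose j) \<le> multiplicity p (ell n)"
  using assms by (intro val_dvd dvd_ell ell_pos) auto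

section \<open>The local analysis at a prime\<close>

lemma val_prod_eq_sum:
  assumes "prime p" "finite A" "0 \<notin> A"
  shows "multiplicity p (\<Prod>A) = (\<Sum>x\<in>A. multiplicity p (x :: nat))"
  using assms by (subst prime_elem_multiplicity_prod_distrib) auto

lemma val_prod_single:
  assumes "prime p" "finite A" "0 \<notin> A" "y \<in> A"
    and "\<And>x. x \<in> A \<Longrightarrow> x \<noteq> y \<Longrightarrow> \<not> p dvd x"
  shows "multiplicity p (\<Prod>A) = multiplicity p (y :: nat)"
proof -
  have "(\<Sum>x\<in>A. multiplicity p x) = (\<Sum>x\<in>{y}. multiplicity p x)"
    using assms by (intro sum.mono_neutral_right) (auto simp: not_dvd_imp_multiplicity_0)
  then show ?thesis using val_prod_eq_sum assms by simp
qed

lemma rising_prod: "0 < q \<Longrightarrow> 0 < x \<Longrightarrow> {x..<x + q} = {Suc (x - 1)..(x - 1) + q}" for x q :: nat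
  by auto

lemma rising_prod_pos: "0 < x \<Longrightarrow> 0 < \<Prod>{x..<x + q}" for x q :: nat
  by (rule prod_pos) auto

text \<open>All that survives of the design: sizes and divisibility. \<open>coeff\<close> comes from
  the polynomial of the intersection numbers. \<open>lambda\<close> at i says that the number of
  blocks through 2 s - i + 1 points is an integer.\<close>

locale tight_parameters =
  fixes s q a b m :: nat
  assumes q3: "3 \<le> q" and qs: "2 * q \<le> s" and sa: "s < a" and sb: "s < b" and m: "m = a + b"
    and coeff: "\<And>j. j \<le> s \<Longrightarrow>
      \<Prod>{Suc m..m + j} dvd (s choose j) * (\<Prod>{Suc a..a + j} * \<Prod>{Suc b..b + j})"
    and lambda: "\<And>i. 1 \<le> i \<Longrightarrow> i \<le> s \<Longrightarrow>
      fact s * \<Prod>{m + i..m + s} dvd \<Prod>{a + i - s..a + s}"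
begin

definition num :: nat where "num = \<Prod>{a..<a + q} * \<Prod>{b..<b + q}"
text \<open>The two ranges mirror the splitting of m + i as (a + l) + (b + (i - l)). For i \<le> q -
  1 both summands are factors of \<open>num\<close>, so m + i may occur twice. For q \<le> i \<le> 2
  q - 1 at least one of l and i - l is below q, so m + i may occur once.\<close>

definition den :: nat where "den = \<Prod>{Suc m..m + (q - 1)} * \<Prod>{Suc m..m + (2 * q - 1)}"

lemma num_pos: "num > 0"
  using sa sb by (simp add: num_def rising_prod_pos)

lemma den_pos: "den > 0"
  unfolding den_def using interval_prod_pos by (intro mult_pos_pos) auto

context
  fixes p :: nat
  assumes p: "prime p"
begin

abbreviation val :: "nat \<Rightarrow> nat" where "val \<equiv> multiplicity p"

lemma val_den: "val den = val (\<Prod>{Suc m..m + (q - 1)}) + val (\<Prod>{Suc m..m + (2 * q - 1)})"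
  unfolding den_def using p interval_prod_pos by (intro val_mult) auto

lemma val_num: "val num = val (\<Prod>{a..<a + q}) + val (\<Prod>{b..<b + q})"
  unfolding num_def using p sa sb by (intro val_mult rising_prod_pos) auto

lemma val_rising_ge_fact: "0 < x \<Longrightarrow> val (fact q :: nat) \<le> val (\<Prod>{x..<x + q})"
  using val_prod_ge_fact[OF p, of q "x - 1"] rising_prod[of q x] q3 by simp

lemma val_rising_ge:
  assumes "0 < x" "l < q"
  shows "val (x + l) + val (fact (q - 1) :: nat) \<le> val (\<Prod>{x..<x + q}) + val ((q - 1) choose l)"
proof -
  have "val (x + l) + val (fact (x + l - Suc (x - 1)) :: nat) + val (fact (x - 1 + q - (x + l)) :: nat)
      \<le> val (\<Prod>{Suc (x - 1)..(x - 1) + q})"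
    using assms by (intro val_prod_ge[OF p]) auto
  moreover have "x + l - Suc (x - 1) = l" "x - 1 + q - (x + l) = q - 1 - l" using assms by auto
  ultimately show ?thesis
    using val_fact_binomial[OF p, of l "q - 1"] assms rising_prod[of q x] by simp
qed

text \<open>The ranges get separate bounds because in \<open>val_matched\<close> the short one can
  have much smaller valuations.\<close>

lemma val_den_le:
  assumes "\<And>i. i \<in> {1..2 * q - 1} \<Longrightarrow> val (m + i) \<le> E" "\<And>i. i \<in> {1..q - 1} \<Longrightarrow> val (m + i) \<le> E'"
  shows "val den \<le> E' + val (fact (q - 2) :: nat) + E + val (fact (2 * q - 2) :: nat)"
proof -
  have "val (\<Prod>{Suc m..m + (q - 1)}) \<le> E' + val (fact (q - 1 - 1) :: nat)"
  proof (rule val_prod_le[OF p])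
    fix y assume "y \<in> {Suc m..m + (q - 1)}"
    then have "y - m \<in> {1..q - 1}" "m + (y - m) = y" by auto
    then show "val y \<le> E'" using assms(2)[of "y - m"] by simp
  qed (use q3 in auto)
  moreover have "val (\<Prod>{Suc m..m + (2 * q - 1)}) \<le> E + val (fact (2 * q - 1 - 1) :: nat)"
  proof (rule val_prod_le[OF p])
    fix y assume "y \<in> {Suc m..m + (2 * q - 1)}"
    then have "y - m \<in> {1..2 * q - 1}" "m + (y - m) = y" by auto
    then show "val y \<le> E" using assms(1)[of "y - m"] by simp
  qed (use q3 in auto)
  moreover have "q - 1 - 1 = q - 2" "2 * q - 1 - 1 = 2 * q - 2" by auto
  ultimately show ?thesis unfolding val_den by simp
qed

text \<open>Used for p \<le> beta, where nothing is matched: the largest factor of each range is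
  given up at the price 2 * E. What remains is at most (q - 2)! (2 q - 2)!, and \<open>num\<close>
  contains q! twice.\<close>

lemma val_den_crude:
  assumes "\<And>i. i \<in> {1..2 * q - 1} \<Longrightarrow> val (m + i) \<le> E"
  shows "val den \<le> val num + 2 * E + val ((2 * q - 2) choose q) + val (fact (q - 2) :: nat)"
proof -
  have "val den \<le> E + val (fact (q - 2) :: nat) + E + val (fact (2 * q - 2) :: nat)"
    using assms q3 by (intro val_den_le) auto
  moreover have "val (fact (2 * q - 2) :: nat)
      = val ((2 * q - 2) choose q) + val (fact q :: nat) + val (fact (q - 2) :: nat)"
  proof -
    have "2 * q - 2 - q = q - 2" by auto
    then show ?thesis using val_fact_binomial[OF p, of q "2 * q - 2"] q3 by simp
  qed
  moreover have "val num \<ge> 2 * val (fact q :: nat)"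
    unfolding val_num using val_rising_ge_fact[of a] val_rising_ge_fact[of b] sa sb by simp
  moreover have "val (fact (q - 2) :: nat) \<le> val (fact q :: nat)"
    by (rule val_fact_le[OF p]) auto
  ultimately show ?thesis by linarith
qed

text \<open>In \<open>lambda\<close>, the divisor contributes at least s! (s - i)! on top of m + i,
  while the window of 2 s - i + 1 integers contributes at most (2 s - i)! on top of its best element
  \<open>y\<close>. The factorials combine to the binomial coefficient, which is the only
  loss.\<close>

lemma val_window:
  assumes "1 \<le> i" "i \<le> s"
  obtains y where "y \<in> {a + i - s..a + s}" "val (m + i) \<le> val y + val ((2 * s - i) choose s)"
proof -
  define x where "x = a + i - s - 1"
  have x: "{a + i - s..a + s} = {Suc x..x + (2 * s - i + 1)}"
    using assms sa by (auto simp: x_def)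
  define F where "F = Max (val ` {Suc x..x + (2 * s - i + 1)})"
  have "F \<in> val ` {Suc x..x + (2 * s - i + 1)}"
    unfolding F_def by (intro Max_in) auto
  then obtain y where y: "y \<in> {Suc x..x + (2 * s - i + 1)}" "F = val y" by blast
  have "val (\<Prod>{Suc x..x + (2 * s - i + 1)}) \<le> F + val (fact (2 * s - i + 1 - 1) :: nat)"
    by (intro val_prod_le[OF p]) (auto simp: F_def)
  moreover have "val (fact s * \<Prod>{m + i..m + s}) \<le> val (\<Prod>{Suc x..x + (2 * s - i + 1)})"
    unfolding x[symmetric] using lambda[OF assms] sa assms by (intro val_dvd[OF p] prod_pos) auto
  moreover have "val (fact s * \<Prod>{m + i..m + s}) = val (fact s :: nat) + val (\<Prod>{m + i..m + s})"
    using assms by (intro val_mult[OF p] prod_pos) auto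
  moreover have "val (m + i) + val (fact (s - i) :: nat) \<le> val (\<Prod>{m + i..m + s})"
  proof -
    have "{m + i..m + s} = {Suc (m + i - 1)..(m + i - 1) + (s - i + 1)}" using assms by auto
    moreover have "(m + i - 1) + (s - i + 1) - (m + i) = s - i" "m + i - Suc (m + i - 1) = 0"
      using assms by auto
    ultimately show ?thesis
      using val_prod_ge[OF p, of "m + i" "m + i - 1" "s - i + 1"] assms by auto
  qed
  moreover have "val (fact (2 * s - i) :: nat)
      = val ((2 * s - i) choose s) + val (fact s :: nat) + val (fact (s - i) :: nat)"
  proof -
    have "2 * s - i - s = s - i" by auto
    then show ?thesis using val_fact_binomial[OF p, of s "2 * s - i"] assms by simp
  qed
  ultimately have "val (m + i) \<le> val y + val ((2 * s - i) choose s)"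
    using y(2) by simp
  then show ?thesis using that y x by auto
qed

text \<open>This is \<open>coeff\<close> at index q - 1. The ranges of \<open>num\<close> start at a
  and b instead of a + 1 and b + 1; the two spare factors later pay for \<open>val a + val b\<close>
  in \<open>val_unmatched\<close>.\<close>

lemma val_first_factor:
  "val a + val b + val (\<Prod>{Suc m..m + (q - 1)}) \<le> val (s choose (q - 1)) + val num"
proof -
  have *: "val (\<Prod>{x..<x + q}) = val x + val (\<Prod>{Suc x..x + (q - 1)})" if "x > 0" for x
  proof -
    have "{x..<x + q} = insert x {Suc x..x + (q - 1)}" using q3 by auto
    then have "\<Prod>{x..<x + q} = x * \<Prod>{Suc x..x + (q - 1)}" by simp
    then show ?thesis using that by (simp add: val_mult[OF p] interval_prod_pos)
  qed
  have "val (\<Prod>{Suc m..m + (q - 1)})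
      \<le> val ((s choose (q - 1)) * (\<Prod>{Suc a..a + (q - 1)} * \<Prod>{Suc b..b + (q - 1)}))"
    using coeff[of "q - 1"] qs by (intro val_dvd[OF p]) (auto intro!: mult_pos_pos interval_prod_pos)
  also have "\<dots> = val (s choose (q - 1)) + (val (\<Prod>{Suc a..a + (q - 1)}) + val (\<Prod>{Suc b..b + (q - 1)}))"
    using qs by (subst val_mult[OF p] | auto intro!: mult_pos_pos interval_prod_pos)+
  finally show ?thesis unfolding val_num using *[of a] *[of b] sa sb by simp
qed

text \<open>Here \<open>y\<close> absorbs the prime power but lies outside \<open>a, \<dots>, a + i\<close>. So the valuation of \<open>a + l\<close>
  is that of its distance to \<open>y\<close>, and these distances are consecutive integers below \<open>s\<close>; this
  makes the numerators of the coefficients of index \<open>i\<close> almost prime to \<open>p\<close>.\<close>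

lemma val_unmatched:
  assumes i: "1 \<le> i" "i \<le> s" and y: "y \<in> {a + i - s..a + s}"
    and less: "\<And>l. l \<le> i \<Longrightarrow> val (a + l) < val y" "\<And>l. l \<le> i \<Longrightarrow> val (a + l) < val (m + i)"
  shows "val (m + i) \<le> val a + val b + val (fact s :: nat) + 2 * val (ell (s - 1))"
proof -
  have ypos: "y > 0" using y sa i by auto
  \<comment> \<open>m + i is the sum of a + l and b + (i - l) and has a larger valuation than the
    first summand, so both summands share their valuation.\<close>
  have bl: "val (b + (i - l)) = val (a + l)" if "l \<le> i" for l
  proof -
    have "m + i - (a + l) = b + (i - l)" using that m by auto
    then show ?thesis
      using val_diff_eq(1)[OF p less(2)[OF that]] m sa sb that by auto
  qed
  define P where "P = \<Prod>{Suc a..a + (i - 1)}"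
  define Q where "Q = \<Prod>{Suc b..b + (i - 1)}"
  have "Q = (\<Prod>l\<in>{1..i - 1}. b + (i - l))"
    unfolding Q_def using i
    by (intro prod.reindex_bij_witness[where i = "\<lambda>l. b + (i - l)" and j = "\<lambda>z. i - (z - b)"]) auto
  moreover have P: "P = (\<Prod>l\<in>{1..i - 1}. a + l)"
    unfolding P_def using i
    by (intro prod.reindex_bij_witness[where i = "\<lambda>l. a + l" and j = "\<lambda>z. z - a"]) auto
  moreover have "val (\<Prod>l\<in>{1..i - 1}. b + (i - l)) \<le> val (\<Prod>l\<in>{1..i - 1}. a + l)"
    using bl by (intro val_prod_mono[OF p]) auto
  ultimately have QP: "val Q \<le> val P" by simp
  \<comment> \<open>The distances from \<open>y\<close> to a + 1, ..., a + i - 1 are at most s - 1,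
    whence \<open>ell (s - 1)\<close>. The factor a + i is kept apart because its distance can be
    s.\<close>
  have valP: "val P \<le> val (fact (i - 1) :: nat) + val (ell (s - 1))"
  proof -
    have "y \<noteq> a + l" if "l \<le> i" for l using less(1)[OF that] by auto
    then consider "y < a" | "a + i < y"
      by (metis le_iff_add linorder_not_less nat_add_left_cancel_le)
    then obtain x where x: "x + (i - 1) \<le> s - 1" "val P \<le> val (\<Prod>{Suc x..x + (i - 1)})"
    proof cases
      case 1
      have "val P \<le> val (\<Prod>l\<in>{1..i - 1}. a + l - y)"
        unfolding P using 1 ypos by (intro val_prod_mono[OF p])
          (auto simp: val_diff_eq(2)[OF p less(1)])
      also have "(\<Prod>l\<in>{1..i - 1}. a + l - y) = \<Prod>{Suc (a - y)..(a - y) + (i - 1)}"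
        using 1 by (intro prod.reindex_bij_witness[where i = "\<lambda>z. z - (a - y)" and j = "\<lambda>l. a + l - y"]) auto
      finally show ?thesis using that[of "a - y"] y i by auto
    next
      case 2
      have "val P \<le> val (\<Prod>l\<in>{1..i - 1}. y - (a + l))"
        unfolding P using 2 ypos sa by (intro val_prod_mono[OF p])
          (auto simp: val_diff_eq(1)[OF p less(1)])
      also have "(\<Prod>l\<in>{1..i - 1}. y - (a + l)) = \<Prod>{Suc (y - a - i)..(y - a - i) + (i - 1)}"
        using 2 by (intro prod.reindex_bij_witness[where i = "\<lambda>z. y - a - z" and j = "\<lambda>l. y - (a + l)"]) auto
      finally show ?thesis using that[of "y - a - i"] 2 y i by auto
    qed
    have "val (\<Prod>{Suc x..x + (i - 1)}) = val (fact (i - 1) :: nat) + val ((x + (i - 1)) choose (i - 1))"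
      unfolding interval_prod by (intro val_mult[OF p]) auto
    moreover have "val ((x + (i - 1)) choose (i - 1)) \<le> val (ell (s - 1))"
      using x(1) by (intro val_binomial_le_ell[OF p]) auto
    ultimately show ?thesis using x(2) by linarith
  qed
  have step: "\<Prod>{Suc x..x + i} = \<Prod>{Suc x..x + (i - 1)} * (x + i)" for x
  proof -
    have "{Suc x..x + i} = insert (x + i) {Suc x..x + (i - 1)}" using i by auto
    then show ?thesis using i by (simp add: mult.commute)
  qed
  have "val (\<Prod>{Suc m..m + i}) \<le> val ((s choose i) * (\<Prod>{Suc a..a + i} * \<Prod>{Suc b..b + i}))"
    using coeff[of i] i by (intro val_dvd[OF p]) (auto intro!: mult_pos_pos interval_prod_pos)
  also have "\<dots> = val (s choose i) + (val (\<Prod>{Suc a..a + i}) + val (\<Prod>{Suc b..b + i}))"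
    using i by (subst val_mult[OF p] | auto intro!: mult_pos_pos interval_prod_pos)+
  also have "val (\<Prod>{Suc a..a + i}) = val P + val (a + i)"
    unfolding P_def step using sa by (intro val_mult[OF p] interval_prod_pos) auto
  also have "val (\<Prod>{Suc b..b + i}) = val Q + val (b + i)"
    unfolding Q_def step using sb by (intro val_mult[OF p] interval_prod_pos) auto
  also have "val (a + i) = val b" using bl[of i] by simp
  also have "val (b + i) = val a" using bl[of 0] by simp
  also have "val (\<Prod>{Suc m..m + i}) = val (\<Prod>{Suc m..m + (i - 1)}) + val (m + i)"
    unfolding step using i by (intro val_mult[OF p] interval_prod_pos) auto
  finally have "val (m + i) + val (\<Prod>{Suc m..m + (i - 1)})
      \<le> val (s choose i) + (val P + val b + (val Q + val a))" by linarith
  moreover have "val (fact (i - 1) :: nat) \<le> val (\<Prod>{Suc m..m + (i - 1)})"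
    by (rule val_prod_ge_fact[OF p])
  moreover have "val (s choose i) + val (fact (i - 1) :: nat) \<le> val (fact s :: nat)"
    using val_fact_binomial[OF p i(2)] val_fact_le[OF p, of "i - 1" i] by linarith
  ultimately show ?thesis using QP valP by linarith
qed

text \<open>Up to the loss \<open>d\<close>, the maximal prime power divides a + l and hence b + (i
  - l). If i \<le> q - 1, \<open>num\<close> receives it twice. Otherwise \<open>num\<close>
  receives it at least once, and the short range of \<open>den\<close> has small valuations, because
  its factors differ from m + i by at most s - 2. The remaining loss \<open>c\<close> is a binomial
  valuation in the first case and the maximum over the short range in the second.\<close>

lemma val_matched:
  assumes i: "i \<in> {1..2 * q - 1}" and max: "\<And>j. j \<in> {1..2 * q - 1} \<Longrightarrow> val (m + j) \<le> val (m + i)"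
    and l: "l \<le> i" "val (m + i) \<le> val (a + l) + d"
  obtains c where "p ^ c \<le> s - 2" "val den \<le> val num + val (fact (2 * q - 2) :: nat) + 2 * d + c"
proof -
  have bl: "val (m + i) \<le> val (b + (i - l)) + d"
  proof -
    have "val (m + i) - d \<le> val (m + i - (a + l))"
    proof (rule val_ge[OF p])
      show "p ^ (val (m + i) - d) dvd m + i - (a + l)"
        using l by (intro dvd_diff_nat multiplicity_dvd') auto
    qed (use m l sb in auto)
    moreover have "m + i - (a + l) = b + (i - l)" using l m by auto
    ultimately show ?thesis by simp
  qed
  define f1 where "f1 = val (fact (q - 1) :: nat)"
  have f2: "val (fact (q - 2) :: nat) \<le> f1" unfolding f1_def by (rule val_fact_le[OF p]) auto
  have f3: "f1 \<le> val (fact q :: nat)" unfolding f1_def by (rule val_fact_le[OF p]) auto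
  have c_le: "val ((q - 1) choose j) \<le> f1" if "j \<le> q - 1" for j
    unfolding f1_def using val_fact_binomial[OF p that] by simp
  show ?thesis
  proof (cases "i \<le> q - 1")
    case True
    then have ll: "l < q" "i - l < q" using l q3 by auto
    have "p ^ val ((q - 1) choose l) \<le> q - 1"
      using ll q3 by (intro pow_val_binomial_le[OF p]) auto
    moreover have "val den \<le> val (m + i) + val (fact (q - 2) :: nat) + val (m + i) + val (fact (2 * q - 2) :: nat)"
      using max q3 by (intro val_den_le) auto
    moreover have "val (a + l) + f1 \<le> val (\<Prod>{a..<a + q}) + val ((q - 1) choose l)"
      unfolding f1_def using ll sa by (intro val_rising_ge) auto
    moreover have "val (b + (i - l)) + f1 \<le> val (\<Prod>{b..<b + q}) + val ((q - 1) choose (i - l))"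
      unfolding f1_def using ll sb by (intro val_rising_ge) auto
    moreover have "val ((q - 1) choose (i - l)) \<le> f1" using c_le ll by simp
    ultimately have "p ^ val ((q - 1) choose l) \<le> s - 2"
      "val den \<le> val num + val (fact (2 * q - 2) :: nat) + 2 * d + val ((q - 1) choose l)"
      using val_num f2 l bl qs by linarith+
    then show ?thesis by (rule that)
  next
    case False
    define e where "e = Max ((\<lambda>i. val (m + i)) ` {1..q - 1})"
    have "e \<in> (\<lambda>i. val (m + i)) ` {1..q - 1}"
      unfolding e_def using q3 by (intro Max_in) auto
    then obtain j where j: "j \<in> {1..q - 1}" "e = val (m + j)" by blast
    have "e \<le> val (i - j)"
    proof -
      have "j \<in> {1..2 * q - 1}" "m + j < m + i" "0 < m + j" "m + i - (m + j) = i - j"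
        using j False by auto
      then have "val (m + j) \<le> val (m + i - (m + j))"
        by (intro val_le_diff[OF p] max)
      then show ?thesis unfolding j(2) by simp
    qed
    then have "p ^ e \<le> p ^ val (i - j)"
      using prime_ge_1_nat[OF p] by (rule power_increasing)
    also have "\<dots> \<le> i - j" using False j by (intro pow_val_le[OF p]) auto
    finally have pe: "p ^ e \<le> s - 2" using i j qs by auto
    have den: "val den \<le> e + val (fact (q - 2) :: nat) + val (m + i) + val (fact (2 * q - 2) :: nat)"
      using max by (intro val_den_le) (auto simp: e_def)
    have "val (m + i) + val (fact (q - 2) :: nat) \<le> val num + d"
    proof (cases "l < q")
      case True
      have "val (a + l) + f1 \<le> val (\<Prod>{a..<a + q}) + val ((q - 1) choose l)"
        unfolding f1_def using True sa by (intro val_rising_ge) auto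
      moreover have "val ((q - 1) choose l) \<le> f1" using True by (intro c_le) auto
      ultimately show ?thesis
        using val_rising_ge_fact[of b] sb val_num f2 f3 l(2) by simp
    next
      case False
      then have il: "i - l < q" using i by auto
      have "val (b + (i - l)) + f1 \<le> val (\<Prod>{b..<b + q}) + val ((q - 1) choose (i - l))"
        unfolding f1_def using il sb by (intro val_rising_ge) auto
      moreover have "val ((q - 1) choose (i - l)) \<le> f1" using il by (intro c_le) auto
      ultimately show ?thesis
        using val_rising_ge_fact[of a] sa val_num f2 f3 bl by simp
    qed
    then show ?thesis using that[OF pe] den by simp
  qed
qed

end

end

text \<open>Pays for the losses of \<open>val_matched\<close> out of \<open>F_tilde\<close>; the
  bound on \<open>d\<close> is the one for the binomial coefficient in \<open>val_window\<close>. If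
  d > 0, then p^(d - 1) \<le> s - 1, so d - 1 is covered by an lcm. Twice this leaves two single
  units: s! always has one, and only p = s lacks the other.\<close>

lemma val_budget:
  assumes p: "prime p" and ps: "p \<le> s" and s6: "6 \<le> s"
    and d: "p ^ d \<le> 2 * s - 1" and c: "p ^ c \<le> s - 2"
  shows "2 * d + c \<le> multiplicity p (fact s :: nat) + 2 * multiplicity p (ell (s - 1))
           + 2 * multiplicity p (ell (s - 2)) + (if p = s then 1 else 0)"
proof -
  have p2: "p \<ge> 2" using p prime_ge_2_nat by blast
  have fs: "1 \<le> multiplicity p (fact s :: nat)"
    using ps p2 by (intro val_ge[OF p]) (auto simp: dvd_fact)
  define l1 where "l1 = multiplicity p (ell (s - 1))"
  define l2 where "l2 = multiplicity p (ell (s - 2))"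
  have l1: "p ^ e \<le> s - 1 \<Longrightarrow> e \<le> l1" and l2: "p ^ e \<le> s - 2 \<Longrightarrow> e \<le> l2" for e
    unfolding l1_def l2_def by (rule le_val_ell[OF p]; assumption)+
  have l12: "l2 \<le> l1" unfolding l1_def l2_def
  proof (intro val_dvd[OF p] ell_pos)
    show "ell (s - 2) dvd ell (s - 1)"
      unfolding ell_def by (rule Lcm_subset) (fastforce)
  qed
  have cl: "c \<le> l2" using l2 c by simp
  have "2 * d + c \<le> multiplicity p (fact s :: nat) + 2 * l1 + 2 * l2 + (if p = s then 1 else 0)"
  proof (cases d)
    case 0
    then show ?thesis using cl by simp
  next
    case (Suc d')
    have "2 * p ^ d' \<le> p ^ d" using p2 Suc by simp
    then have pd: "p ^ d' \<le> s - 1" using d by linarith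
    then have d': "d' \<le> l1" by (rule l1)
    show ?thesis
    proof (cases "p = s")
      case True
      have "d' = 0"
      proof (rule ccontr)
        assume "d' \<noteq> 0"
        then have "p ^ 1 \<le> p ^ d'" using p2 by (intro power_increasing) auto
        then show False using pd True s6 by simp
      qed
      then show ?thesis using True Suc fs cl by simp
    next
      case False
      then have "1 \<le> l1" using l1[of 1] ps by simp
      show ?thesis
      \<comment> \<open>If p^d' is exactly s - 1, \<open>ell (s - 2)\<close> need not contain it.
        But then d' > 1, as p = s - 1 would make p^2 exceed 2 s - 1. So p \<le> s - 2, and
        \<open>ell (s - 2)\<close> supplies the missing unit.\<close>
      proof (cases "p ^ d' = s - 1")
        case eq: True
        have "d' \<noteq> 0" using eq s6 by (cases d') auto
        then obtain d'' where d'': "d' = Suc d''" by (cases d') auto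
        have "d'' \<noteq> 0"
        proof
          assume "d'' = 0"
          then have ps1: "p = s - 1" "p ^ d = p * p" using eq Suc d'' by auto
          have "5 * (s - 1) \<le> p * p" unfolding ps1 using s6 by (intro mult_le_mono) auto
          then show False using ps1 d s6 by linarith
        qed
        then have "p ^ 1 \<le> p ^ d''" using p2 by (intro power_increasing) auto
        then have "p * 2 \<le> p * p ^ d''" using p2 by (intro mult_le_mono) auto
        then have "p ^ 1 * 2 \<le> p ^ d'" unfolding d'' by simp
        then have "1 \<le> l2" using eq s6 by (intro l2) linarith
        then show ?thesis using d' cl Suc fs by simp
      next
        case ne: False
        then have "d' \<le> l2" using pd by (intro l2) linarith
        then show ?thesis using d' cl Suc fs \<open>1 \<le> l1\<close> by simp
      qed
    qed
  qed
  then show ?thesis unfolding l1_def l2_def .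
qed

section \<open>The total deficit at a prime\<close>

context tight_parameters
begin

context
  fixes p :: nat
  assumes p: "prime p"
begin

text \<open>The exceptional unit is confined to p = s - 1 and p = s. If s = 2 q it is avoided: then
  s is even and not prime, and p = s - 1 divides (2 q)! but not (2 q - 2)!.\<close>

lemma val_den_le_small:
  assumes ps: "p \<le> s"
  shows "multiplicity p den \<le> multiplicity p num + multiplicity p (fact s :: nat)
    + multiplicity p (fact (2 * q) :: nat) + 2 * multiplicity p (ell (s - 1))
    + 2 * multiplicity p (ell (s - 2)) + (if s \<le> p + 1 \<and> 2 * q < s then 1 else 0)"
proof -
  have s6: "6 \<le> s" using q3 qs by simp
  have s_not_prime: "p \<noteq> s" if "s = 2 * q"
    using p q3 that prime_product[of 2 q] by auto
  have f2q: "val p (fact (2 * q - 2) :: nat) \<le> val p (fact (2 * q) :: nat)"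
    by (rule val_fact_le[OF p]) auto
  define E where "E = Max ((\<lambda>i. val p (m + i)) ` {1..2 * q - 1})"
  have "E \<in> (\<lambda>i. val p (m + i)) ` {1..2 * q - 1}"
    unfolding E_def using q3 by (intro Max_in) auto
  then obtain i where i: "i \<in> {1..2 * q - 1}" "E = val p (m + i)" by blast
  have max: "val p (m + j) \<le> val p (m + i)" if "j \<in> {1..2 * q - 1}" for j
    unfolding i(2)[symmetric] E_def using that by auto
  have ib: "1 \<le> i" "i \<le> s" using i qs by auto
  obtain y where y: "y \<in> {a + i - s..a + s}" "val p (m + i) \<le> val p y + val p ((2 * s - i) choose s)"
    using val_window[OF p ib] by blast
  define d where "d = val p ((2 * s - i) choose s)"
  show ?thesis
  \<comment> \<open>If no a + l takes up the maximal prime power within the loss \<open>d\<close>,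
    then \<open>y\<close> is none of them, and \<open>val_unmatched\<close> bounds that prime power
    itself.\<close>
  proof (cases "\<exists>l\<le>i. val p (m + i) \<le> val p (a + l) + d")
    case True
    then obtain l where "l \<le> i" "val p (m + i) \<le> val p (a + l) + d" by blast
    then obtain c where c: "p ^ c \<le> s - 2" "val p den \<le> val p num + val p (fact (2 * q - 2) :: nat) + 2 * d + c"
      using val_matched[OF p i(1) max] by blast
    have "p ^ d \<le> 2 * s - i"
      unfolding d_def using ib by (intro pow_val_binomial_le[OF p]) auto
    then have "p ^ d \<le> 2 * s - 1" using ib by linarith
    note val_budget[OF p ps s6 this c(1)]
    moreover have "(if p = s then 1 else 0) \<le> (if s \<le> p + 1 \<and> 2 * q < s then 1 else (0 :: nat))"
      using s_not_prime qs by auto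
    ultimately show ?thesis using c(2) f2q by linarith
  next
    case False
    then have less: "val p (a + l) + d < val p (m + i)" if "l \<le> i" for l
      using that by (meson not_le)
    have E: "val p (m + i) \<le> val p a + val p b + val p (fact s :: nat) + 2 * val p (ell (s - 1))"
    proof (rule val_unmatched[OF p ib y(1)])
      show "val p (a + l) < val p (m + i)" if "l \<le> i" for l using less[OF that] by simp
      show "val p (a + l) < val p y" if "l \<le> i" for l using less[OF that] y(2) d_def by simp
    qed
    have "val p (\<Prod>{Suc m..m + (2 * q - 1)}) \<le> val p (m + i) + val p (fact (2 * q - 1 - 1) :: nat)"
    proof (rule val_prod_le[OF p])
      fix z assume "z \<in> {Suc m..m + (2 * q - 1)}"
      then have "z - m \<in> {1..2 * q - 1}" "m + (z - m) = z" by auto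
      then show "val p z \<le> val p (m + i)" using max[of "z - m"] by simp
    qed (use q3 in auto)
    moreover have "2 * q - 1 - 1 = 2 * q - 2" by simp
    ultimately have D: "val p den \<le> val p (s choose (q - 1)) + val p num + val p (fact (2 * q - 2) :: nat)
        + val p (fact s :: nat) + 2 * val p (ell (s - 1))"
      using val_first_factor[OF p] E val_den[OF p] by simp
    define c where "c = val p (s choose (q - 1))"
    have pc: "p ^ c \<le> s" unfolding c_def using qs s6 by (intro pow_val_binomial_le[OF p]) auto
    have c: "c \<le> val p (ell (s - 2)) + 1"
    proof (cases c)
      case (Suc c')
      have "2 * p ^ c' \<le> p ^ c" using Suc prime_ge_2_nat[OF p] by simp
      then have "p ^ c' \<le> s - 2" using pc s6 by linarith
      then show ?thesis using le_val_ell[OF p] Suc by simp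
    qed simp
    have "c + val p (fact (2 * q - 2) :: nat) \<le> val p (fact (2 * q) :: nat) + 2 * val p (ell (s - 2))
        + (if s \<le> p + 1 \<and> 2 * q < s then 1 else 0)"
    proof (cases "p \<le> s - 2")
      case True
      then have "1 \<le> val p (ell (s - 2))" using le_val_ell[OF p, of 1 "s - 2"] by simp
      then show ?thesis using c f2q by simp
    next
      case large: False
      have c1: "c \<le> 1"
      proof (rule ccontr)
        assume "\<not> c \<le> 1"
        then have "p ^ 2 \<le> p ^ c" using prime_ge_1_nat[OF p] by (intro power_increasing) auto
        moreover have "5 * (s - 1) \<le> p ^ 2"
          unfolding power2_eq_square using large s6 by (intro mult_le_mono) auto
        ultimately show False using pc s6 by linarith
      qed
      show ?thesis
      proof (cases "2 * q < s")
        case True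
        moreover have "s \<le> p + 1" using large s6 by linarith
        ultimately show ?thesis using c1 f2q by simp
      next
        case False
        then have s: "s = 2 * q" using qs by simp
        have "\<not> p dvd (fact (2 * q - 2) :: nat)"
          using large s by (simp add: prime_dvd_fact_iff[OF p])
        then have "val p (fact (2 * q - 2) :: nat) = 0" by (rule not_dvd_imp_multiplicity_0)
        moreover have "1 \<le> val p (fact (2 * q) :: nat)"
          using ps s prime_ge_1_nat[OF p] by (intro val_ge[OF p]) (auto simp: dvd_fact)
        ultimately show ?thesis using c1 by simp
      qed
    qed
    then show ?thesis using D c_def by linarith
  qed
qed

text \<open>Each interval involved contains at most one multiple of p. \<open>coeff\<close> at index
  i, whose binomial coefficient is prime to p, locates a multiple a + l or one on the side of b,
  which amounts to the same. Then \<open>lambda\<close> forces the full power of p in m + i into the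
  single multiple a + l of its window.\<close>

lemma val_den_le_large:
  assumes ps: "s < p"
  shows "multiplicity p den \<le> multiplicity p num"
proof (cases "\<exists>i\<in>{1..2 * q - 1}. p dvd m + i")
  case False
  have nd: "\<not> p dvd z" if "z \<in> {Suc m..m + (2 * q - 1)}" for z
  proof -
    have "z - m \<in> {1..2 * q - 1}" "m + (z - m) = z" using that by auto
    then show ?thesis using False by metis
  qed
  have "\<not> p dvd den"
    unfolding den_def using p nd
    by (auto simp: prime_dvd_mult_iff prime_dvd_prod_iff)
  then show ?thesis by (simp add: not_dvd_imp_multiplicity_0)
next
  case True
  then obtain i where i: "i \<in> {1..2 * q - 1}" "p dvd m + i" by blast
  have ib: "1 \<le> i" "i \<le> s" using i qs by auto
  have uniq: "z = z'" if "p dvd z" "p dvd z'" "z < z' + p" "z' < z + p" for z z'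
  proof (rule ccontr)
    assume "z \<noteq> z'"
    then consider "z < z'" | "z' < z" by linarith
    then show False
    proof cases
      case 1
      then have "p \<le> z' - z" using that by (intro dvd_imp_le dvd_diff_nat) auto
      then show False using that 1 by linarith
    next
      case 2
      then have "p \<le> z - z'" using that by (intro dvd_imp_le dvd_diff_nat) auto
      then show False using that 2 by linarith
    qed
  qed
  have nsm: "\<not> p dvd z" if "z \<in> {Suc m..m + s}" "z \<noteq> m + i" for z
    using uniq[of z "m + i"] i that ps ib by auto
  have c0: "\<not> p dvd (s choose i)"
  proof
    assume "p dvd (s choose i)"
    then have "p ^ 1 \<le> p ^ val p (s choose i)"
      using ib prime_ge_1_nat[OF p]
      by (intro power_increasing val_ge[OF p]) auto
    also have "\<dots> \<le> s" using ib by (intro pow_val_binomial_le[OF p]) auto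
    finally show False using ps by simp
  qed
  have "p dvd (s choose i) * (\<Prod>{Suc a..a + i} * \<Prod>{Suc b..b + i})"
    using i(2) ib by (intro dvd_trans[OF _ coeff[OF ib(2)]] dvd_trans[OF _ dvd_prodI[of _ "m + i"]]) auto
  then consider z where "z \<in> {Suc a..a + i}" "p dvd z" | z where "z \<in> {Suc b..b + i}" "p dvd z"
    using p c0 by (auto simp: prime_dvd_mult_iff prime_dvd_prod_iff)
  then obtain l where l: "l \<le> i" "p dvd a + l"
  proof cases
    case 1
    then show ?thesis using that[of "z - a"] by auto
  next
    case 2
    then have "p dvd m + i - z" using i by (intro dvd_diff_nat)
    moreover have "m + i - z = a + (i - (z - b))" using 2 m by auto
    ultimately show ?thesis using that[of "i - (z - b)"] by auto
  qed
  have Ea: "val p (m + i) \<le> val p (a + l)"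
  proof -
    have "val p (m + i) \<le> val p (fact s * \<Prod>{m + i..m + s})"
    proof (rule val_dvd[OF p])
      show "m + i dvd fact s * \<Prod>{m + i..m + s}"
        using ib by (intro dvd_mult dvd_prodI) auto
      show "0 < fact s * \<Prod>{m + i..m + s}" using ib by (auto intro!: prod_pos)
    qed
    also have "\<dots> \<le> val p (\<Prod>{a + i - s..a + s})"
      using lambda[OF ib] sa ib by (intro val_dvd[OF p] prod_pos) auto
    also have "\<dots> = val p (a + l)"
    proof (rule val_prod_single[OF p])
      show "\<not> p dvd x" if "x \<in> {a + i - s..a + s}" "x \<noteq> a + l" for x
      proof -
        \<comment> \<open>The window can be longer than p, but all its elements are within s < p of
          a + l.\<close>
        have lt: "x < a + l + p" "a + l < x + p" using that l ps ib sa by auto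
        show ?thesis
        proof
          assume "p dvd x"
          then have "x = a + l" using l(2) lt by (rule uniq)
          then show False using that by simp
        qed
      qed
    qed (use sa ib l in auto)
    finally show ?thesis .
  qed
  have Eb: "val p (m + i) \<le> val p (b + (i - l))"
  proof (rule val_ge[OF p])
    have "p ^ val p (m + i) dvd m + i - (a + l)"
      using Ea by (intro dvd_diff_nat multiplicity_dvd multiplicity_dvd')
    then show "p ^ val p (m + i) dvd b + (i - l)" using m l by (simp add: algebra_simps)
  qed (use sb in auto)
  have up: "val p (x + j) \<le> val p (\<Prod>{x..<x + q})" if "0 < x" "j < q" for x j
    using that by (intro val_dvd[OF p] dvd_prodI rising_prod_pos) auto
  have den2: "val p (\<Prod>{Suc m..m + (2 * q - 1)}) = val p (m + i)"
    using i nsm qs by (intro val_prod_single[OF p]) auto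
  show ?thesis
  proof (cases "i \<le> q - 1")
    case True
    have "val p (\<Prod>{Suc m..m + (q - 1)}) = val p (m + i)"
      using i True nsm qs by (intro val_prod_single[OF p]) auto
    moreover have "l < q" "i - l < q" using l(1) True q3 by auto
    ultimately show ?thesis
      unfolding val_den[OF p] val_num[OF p] den2
      using Ea Eb up[of a l] up[of b "i - l"] sa sb by simp
  next
    case False
    have "val p (\<Prod>{Suc m..m + (q - 1)}) = 0"
    proof (rule not_dvd_imp_multiplicity_0)
      show "\<not> p dvd \<Prod>{Suc m..m + (q - 1)}"
        using nsm False qs p by (auto simp: prime_dvd_prod_iff)
    qed
    then have "val p den = val p (m + i)" unfolding val_den[OF p] den2 by simp
    moreover have "val p (m + i) \<le> val p num"
    proof (cases "l < q")
      case True
      then show ?thesis unfolding val_num[OF p] using Ea up[of a l] sa by simp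
    next
      case False
      then have "i - l < q" using i by auto
      then show ?thesis unfolding val_num[OF p] using Eb up[of b "i - l"] sb by simp
    qed
    ultimately show ?thesis by simp
  qed
qed

end

end

section \<open>Intersection numbers of tight designs\<close>

text \<open>Inclusion-exclusion for the n-subsets of a k-set that miss w given points. It converts
  between binomials in \<open>card (K - X)\<close> and in
  \<open>card (K \<inter> X)\<close>.\<close>

lemma binomial_alternating:
  assumes "w \<le> k" "n \<le> k"
  shows "(\<Sum>i\<le>n. (-1) ^ i * (real (w choose i) * real ((k - i) choose (n - i)))) = real ((k - w) choose n)"
  using assms
proof (induction w arbitrary: k n)
  case 0
  have "(\<Sum>i\<le>n. (-1) ^ i * (real (0 choose i) * real ((k - i) choose (n - i))))
      = (\<Sum>i\<in>{0}. (-1) ^ i * (real (0 choose i) * real ((k - i) choose (n - i))))"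
    by (intro sum.mono_neutral_right) auto
  then show ?case by simp
next
  case (Suc w)
  show ?case
  proof (cases n)
    case 0
    then show ?thesis by simp
  next
    case (Suc n')
    obtain k' where k: "k = Suc k'" using Suc.prems by (cases k) auto
    have "(\<Sum>i\<le>n. (-1) ^ i * (real (Suc w choose i) * real ((k - i) choose (n - i))))
        = real (k choose n) + (\<Sum>i\<le>n'. (-1) ^ Suc i * (real (w choose Suc i) * real ((k' - i) choose (n' - i))))
          - (\<Sum>i\<le>n'. (-1) ^ i * (real (w choose i) * real ((k' - i) choose (n' - i))))"
      unfolding Suc k by (subst sum.atMost_Suc_shift)
        (simp add: sum.distrib[symmetric] sum_subtractf[symmetric] sum_negf[symmetric] algebra_simps del: sum.atMost_Suc)
    also have "real (k choose n) + (\<Sum>i\<le>n'. (-1) ^ Suc i * (real (w choose Suc i) * real ((k' - i) choose (n' - i))))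
        = (\<Sum>i\<le>n. (-1) ^ i * (real (w choose i) * real ((k - i) choose (n - i))))"
      unfolding Suc k by (simp add: sum.atMost_Suc_shift del: sum.atMost_Suc)
    also have "\<dots> = real ((k - w) choose n)"
      using Suc.prems by (intro Suc.IH) auto
    also have "(\<Sum>i\<le>n'. (-1) ^ i * (real (w choose i) * real ((k' - i) choose (n' - i)))) = real ((k' - w) choose n')"
      using Suc.prems k Suc by (intro Suc.IH) auto
    also have "real ((k - w) choose n) - real ((k' - w) choose n') = real ((k - Suc w) choose n)"
    proof -
      have "k - w = Suc (k' - w)" "k - Suc w = k' - w" using Suc.prems k by auto
      then show ?thesis unfolding Suc by simp
    qed
    finally show ?thesis .
  qed
qed

text \<open>A polynomial of degree at most n with more than n zeros vanishes everywhere. Its values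
  at 0, ..., n are triangular in the binomial coordinates, which therefore vanish one after the
  other.\<close>

lemma binomial_sum_zero:
  fixes e :: "nat \<Rightarrow> real"
  assumes "finite Z" "n < card Z" and zero: "\<And>z. z \<in> Z \<Longrightarrow> (\<Sum>i\<le>n. e i * real (z choose i)) = 0"
    and "i \<le> n"
  shows "e i = 0"
proof -
  define P :: "nat \<Rightarrow> real poly" where "P = (\<lambda>i. smult (1 / fact i) (\<Prod>j<i. [:- real j, 1:]))"
  define Q where "Q = (\<Sum>i\<le>n. smult (e i) (P i))"
  have P: "poly (P i) (real z) = real (z choose i)" for i z
  proof -
    have "poly (\<Prod>j<i. [:- real j, 1:]) (real z) = (\<Prod>j<i. real z - real j)"
      by (simp add: poly_prod)
    then show ?thesis
      by (simp add: P_def binomial_gbinomial gbinomial_prod_rev atLeast0LessThan)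
  qed
  have Q: "poly Q (real z) = (\<Sum>i\<le>n. e i * real (z choose i))" for z
    by (simp add: Q_def poly_sum P)
  have "degree (P i) \<le> i" for i
  proof -
    have "degree (\<Prod>j<i. [:- real j, 1:]) \<le> sum (degree \<circ> (\<lambda>j. [:- real j, 1:])) {..<i}"
      by (rule degree_prod_sum_le) auto
    then show ?thesis unfolding P_def by (simp add: degree_smult_le)
  qed
  then have degQ: "degree Q \<le> n"
    unfolding Q_def by (intro degree_sum_le) (auto intro: order.trans[OF degree_smult_le] order.trans)
  have "Q = 0"
  proof (rule ccontr)
    assume "Q \<noteq> 0"
    then have "card {x. poly Q x = 0} \<le> n"
      using card_poly_roots_bound degQ order.trans by blast
    moreover have "card (real ` Z) \<le> card {x. poly Q x = 0}"
      using poly_roots_finite[OF \<open>Q \<noteq> 0\<close>] zero Q by (intro card_mono) auto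
    moreover have "card (real ` Z) = card Z" by (simp add: card_image inj_on_def)
    ultimately show False using assms by simp
  qed
  then have all: "(\<Sum>i\<le>n. e i * real (z choose i)) = 0" for z
    using Q[of z] by simp
  show "e i = 0" using assms(4)
  proof (induction i rule: less_induct)
    case (less i)
    have "(\<Sum>j\<le>n. e j * real (i choose j)) = (\<Sum>j\<in>{i}. e j * real (i choose j))"
    proof (intro sum.mono_neutral_right ballI)
      fix j assume "j \<in> {..n} - {i}"
      then show "e j * real (i choose j) = 0"
        using less.IH[of j] by (cases "j < i") auto
    qed (use less in auto)
    then show ?case using all[of i] by simp
  qed
qed

text \<open>The falling factorials i! (z choose i) are monic with integer coefficients, so a monic
  integer polynomial has integer coordinates with respect to them. Up to sign, these integers become
  the quotients in \<open>coefficient_dvd\<close>.\<close>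

lemma prod_falling_expansion:
  fixes Z :: "nat set"
  assumes "finite Z"
  shows "\<exists>d :: nat \<Rightarrow> int. d (card Z) = 1 \<and>
    (\<forall>z. (\<Prod>x\<in>Z. real z - real x) = (\<Sum>i\<le>card Z. of_int (d i) * fact i * real (z choose i)))"
  using assms
proof (induction Z rule: finite_induct)
  case empty
  show ?case by (intro exI[of _ "\<lambda>_. 1"]) auto
next
  case (insert x Z)
  then obtain d where d: "d (card Z) = 1"
    "\<And>z. (\<Prod>x\<in>Z. real z - real x) = (\<Sum>i\<le>card Z. of_int (d i) * fact i * real (z choose i))"
    by blast
  define n where "n = card Z"
  define e where "e = (\<lambda>i. (if i = 0 then 0 else d (i - 1)) + (if i \<le> n then (int i - int x) * d i else 0))"
  \<comment> \<open>Multiplication by z in the binomial basis, from which the recurrence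
    \<open>e\<close> is read off.\<close>
  have step: "real z * real (z choose i) = real (Suc i) * real (z choose Suc i) + real i * real (z choose i)" for z i
  proof (cases "i \<le> z")
    case True
    have "Suc i * (z choose Suc i) = (z - i) * (z choose i)"
      using binomial_absorb_comp[of z i] binomial_absorption[of i z]
      by (cases z) auto
    then have "real (Suc i) * real (z choose Suc i) = (real z - real i) * real (z choose i)"
      using True by (metis of_nat_diff of_nat_mult)
    then show ?thesis by (simp add: algebra_simps)
  qed (simp add: binomial_eq_0)
  have "e (card (insert x Z)) = 1"
    using insert d by (simp add: e_def n_def)
  moreover have "(\<Prod>x\<in>insert x Z. real z - real x) = (\<Sum>i\<le>Suc n. of_int (e i) * fact i * real (z choose i))" for z
  proof -
    have "(\<Prod>x\<in>insert x Z. real z - real x) = (\<Sum>i\<le>n. (real z - real x) * (of_int (d i) * fact i * real (z choose i)))"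
      using insert d(2)[of z] by (simp add: n_def sum_distrib_left)
    also have "\<dots> = (\<Sum>i\<le>n. of_int (d i) * fact (Suc i) * real (z choose Suc i))
        + (\<Sum>i\<le>n. (real i - real x) * of_int (d i) * fact i * real (z choose i))"
      unfolding sum.distrib[symmetric]
    proof (rule sum.cong[OF refl])
      fix i
      have "(real z - real x) * (of_int (d i) * fact i * real (z choose i))
          = of_int (d i) * fact i * (real z * real (z choose i)) - real x * of_int (d i) * fact i * real (z choose i)"
        by (simp add: algebra_simps)
      then show "(real z - real x) * (of_int (d i) * fact i * real (z choose i))
          = of_int (d i) * fact (Suc i) * real (z choose Suc i) + (real i - real x) * of_int (d i) * fact i * real (z choose i)"
        unfolding step by (simp add: algebra_simps)
    qed
    also have "(\<Sum>i\<le>n. of_int (d i) * fact (Suc i) * real (z choose Suc i))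
        = (\<Sum>i\<le>Suc n. (if i = 0 then 0 else of_int (d (i - 1))) * fact i * real (z choose i))"
      by (simp add: sum.atMost_Suc_shift del: sum.atMost_Suc fact_Suc)
    also have "(\<Sum>i\<le>n. (real i - real x) * of_int (d i) * fact i * real (z choose i))
        = (\<Sum>i\<le>Suc n. (if i \<le> n then (real i - real x) * of_int (d i) else 0) * fact i * real (z choose i))"
      by simp
    also have "(\<Sum>i\<le>Suc n. (if i = 0 then 0 else of_int (d (i - 1))) * fact i * real (z choose i)) + \<dots>
        = (\<Sum>i\<le>Suc n. of_int (e i) * fact i * real (z choose i))"
      unfolding sum.distrib[symmetric] by (intro sum.cong) (auto simp: e_def algebra_simps)
    finally show ?thesis .
  qed
  ultimately show ?case using insert n_def by auto
qed

lemma card_subsets_indicator: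
  assumes "finite A"
  shows "real (card (A - X) choose i) = (\<Sum>I | I \<subseteq> A \<and> card I = i. if X \<inter> I = {} then 1 else 0)"
proof -
  have "card (A - X) choose i = card {I. I \<subseteq> A - X \<and> card I = i}"
    using n_subsets[of "A - X" i] assms by simp
  also have "{I. I \<subseteq> A - X \<and> card I = i} = {I \<in> {I. I \<subseteq> A \<and> card I = i}. X \<inter> I = {}}"
    by auto
  also have "\<dots> = {I. I \<subseteq> A \<and> card I = i} \<inter> {I. X \<inter> I = {}}"
    by auto
  finally show ?thesis
    using assms by (simp add: sum.If_cases)
qed

lemma card_between:
  assumes "finite X" "T \<subseteq> X" "card T \<le> n"
  shows "card {S. T \<subseteq> S \<and> S \<subseteq> X \<and> card S = n} = (card X - card T) choose (n - card T)"
proof -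
  have fT: "finite T" using assms finite_subset by blast
  have "bij_betw (\<lambda>S. S - T) {S. T \<subseteq> S \<and> S \<subseteq> X \<and> card S = n} {R. R \<subseteq> X - T \<and> card R = n - card T}"
  proof (rule bij_betw_byWitness[where f' = "\<lambda>R. R \<union> T"])
    show "(\<lambda>S. S - T) ` {S. T \<subseteq> S \<and> S \<subseteq> X \<and> card S = n} \<subseteq> {R. R \<subseteq> X - T \<and> card R = n - card T}"
      using fT by (auto simp: card_Diff_subset)
    show "(\<lambda>R. R \<union> T) ` {R. R \<subseteq> X - T \<and> card R = n - card T} \<subseteq> {S. T \<subseteq> S \<and> S \<subseteq> X \<and> card S = n}"
    proof safe
      fix R assume R: "R \<subseteq> X - T" "card R = n - card T"
      then have "finite R" "R \<inter> T = {}" using assms finite_subset[of R "X - T"] by auto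
      then show "card (R \<union> T) = n" using R fT assms by (simp add: card_Un_disjoint)
    qed (use assms in auto)
  qed (use assms in auto)
  then have "card {S. T \<subseteq> S \<and> S \<subseteq> X \<and> card S = n} = card {R. R \<subseteq> X - T \<and> card R = n - card T}"
    by (rule bij_betw_same_card)
  also have "\<dots> = card (X - T) choose (n - card T)"
    using assms by (intro n_subsets) auto
  finally show ?thesis using assms fT by (simp add: card_Diff_subset)
qed

section \<open>The blocks as seen from a fixed block \<open>K\<close>\<close>

text \<open>\<open>mu\<close> stands for the proportion of the k-subsets that are blocks.\<close>

locale tight_blocks =
  fixes s v k :: nat and mu :: real and V :: "'a set" and B :: "'a set set"
  assumes finV: "finite V" and cardV: "card V = v" and sk: "s \<le> k" and kv: "k + s \<le> v"
    and mu: "mu > 0"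
    and block: "\<And>X. X \<in> B \<Longrightarrow> X \<subseteq> V \<and> card X = k"
    and count: "\<And>J I. J \<subseteq> V \<Longrightarrow> I \<subseteq> V \<Longrightarrow> J \<inter> I = {} \<Longrightarrow> card J = s \<Longrightarrow> card I \<le> s \<Longrightarrow>
      real (card {X \<in> B. J \<subseteq> X \<and> X \<inter> I = {}}) = mu * real ((v - s - card I) choose (k - s))"
    and tight: "mu * real (v choose k) = real (v choose s)"
begin

definition bs :: "nat \<Rightarrow> real" where "bs i = mu * real ((v - s - i) choose (k - s))"
text \<open>Chosen so that \<open>g i * bs i\<close> is the coefficient in
  \<open>binomial_alternating\<close> with n = s. In the binomial basis these numbers give the
  polynomial in \<open>card (K - X)\<close> that vanishes at every block X other than
  \<open>K\<close>.\<close>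

definition g :: "nat \<Rightarrow> real" where "g i = (-1) ^ i * real ((k - i) choose (s - i)) / bs i"

lemma bs_pos: "i \<le> s \<Longrightarrow> bs i > 0"
  unfolding bs_def using mu kv by (intro mult_pos_pos) auto

lemma finite_block: "X \<in> B \<Longrightarrow> finite X"
  using block finV finite_subset by metis

lemma finB: "finite B"
  by (rule finite_subset[of _ "Pow V"]) (use block finV in auto)

text \<open>Here tightness enters: it makes \<open>g 0\<close>, which is the value of
  \<open>F\<close> at \<open>K\<close>, equal to 1.\<close>

lemma bs_0: "bs 0 = real (k choose s)"
proof -
  have "(v choose k) * (k choose s) = (v choose s) * ((v - s) choose (k - s))"
    using sk kv by (intro choose_mult) auto
  then have "real (v choose k) * real (k choose s) = real (v choose s) * real ((v - s) choose (k - s))"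
    by (metis of_nat_mult)
  then have "real (v choose s) * (mu * real ((v - s) choose (k - s))) = real (v choose s) * real (k choose s)"
    using tight by (metis (no_types, lifting) mult.assoc mult.left_commute)
  moreover have "real (v choose s) \<noteq> 0" using kv by simp
  ultimately show ?thesis unfolding bs_def by simp
qed

context
  fixes K :: "'a set"
  assumes K: "K \<in> B"
begin

lemma finK: "finite K" and KV: "K \<subseteq> V" and cardK: "card K = k"
  using block[OF K] finV finite_subset by auto

text \<open>Double counting of the pairs of a block X through \<open>S\<close> and an i-subset of
  \<open>K\<close> disjoint from X.\<close>

lemma sum_containing:
  assumes S: "S \<subseteq> V" "card S = s" and i: "i \<le> s"
  shows "(\<Sum>X | X \<in> B \<and> S \<subseteq> X. real (card (K - X) choose i)) = bs i * real (card (K - S) choose i)"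
proof -
  have "(\<Sum>X | X \<in> B \<and> S \<subseteq> X. real (card (K - X) choose i))
      = (\<Sum>X | X \<in> B \<and> S \<subseteq> X. \<Sum>I | I \<subseteq> K \<and> card I = i. if X \<inter> I = {} then 1 else 0)"
    by (simp add: card_subsets_indicator[OF finK])
  also have "\<dots> = (\<Sum>I | I \<subseteq> K \<and> card I = i. \<Sum>X | X \<in> B \<and> S \<subseteq> X. if X \<inter> I = {} then 1 else 0)"
    by (rule sum.swap)
  also have "\<dots> = (\<Sum>I | I \<subseteq> K \<and> card I = i. if S \<inter> I = {} then bs i else 0)"
  proof (rule sum.cong[OF refl])
    fix I assume "I \<in> {I. I \<subseteq> K \<and> card I = i}"
    then have I: "I \<subseteq> V" "card I = i" using KV by auto
    have "(\<Sum>X | X \<in> B \<and> S \<subseteq> X. if X \<inter> I = {} then 1 else 0) = real (card {X \<in> B. S \<subseteq> X \<and> X \<inter> I = {}})"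
    proof -
      have "{X. X \<in> B \<and> S \<subseteq> X} \<inter> {X. X \<inter> I = {}} = {X \<in> B. S \<subseteq> X \<and> X \<inter> I = {}}" by auto
      then show ?thesis using finB by (simp add: sum.If_cases)
    qed
    also have "\<dots> = (if S \<inter> I = {} then bs i else 0)"
    proof (cases "S \<inter> I = {}")
      case True
      then show ?thesis using count[of S I] S I i by (simp add: bs_def)
    next
      case False
      then have eq: "{X \<in> B. S \<subseteq> X \<and> X \<inter> I = {}} = {}" by auto
      show ?thesis unfolding eq using False by simp
    qed
    finally show "(\<Sum>X | X \<in> B \<and> S \<subseteq> X. if X \<inter> I = {} then 1 else 0) = (if S \<inter> I = {} then bs i else 0)" .
  qed
  also have "\<dots> = bs i * (\<Sum>I | I \<subseteq> K \<and> card I = i. if S \<inter> I = {} then 1 else 0)"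
    unfolding sum_distrib_left by (intro sum.cong) auto
  finally show ?thesis by (simp add: card_subsets_indicator[OF finK])
qed

lemma sum_containing_comb:
  fixes c :: "nat \<Rightarrow> real"
  assumes S: "S \<subseteq> V" "card S = s" and n: "n \<le> s"
  shows "(\<Sum>X | X \<in> B \<and> S \<subseteq> X. \<Sum>i\<le>n. c i * real (card (K - X) choose i))
      = (\<Sum>i\<le>n. c i * bs i * real (card (K - S) choose i))"
proof -
  have "(\<Sum>X | X \<in> B \<and> S \<subseteq> X. \<Sum>i\<le>n. c i * real (card (K - X) choose i))
      = (\<Sum>i\<le>n. c i * (\<Sum>X | X \<in> B \<and> S \<subseteq> X. real (card (K - X) choose i)))"
    unfolding sum_distrib_left by (rule sum.swap)
  also have "\<dots> = (\<Sum>i\<le>n. c i * (bs i * real (card (K - S) choose i)))"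
    using n by (intro sum.cong refl) (simp add: sum_containing[OF S])
  finally show ?thesis by (simp add: mult.assoc)
qed

definition F :: "'a set \<Rightarrow> real" where
  "F X = (\<Sum>i\<le>s. g i * real (card (K - X) choose i))"

text \<open>The indicator of \<open>K\<close> has the same sums over the blocks through
  \<open>S\<close>; \<open>F\<close> is built to imitate it.\<close>

lemma sum_F_containing:
  assumes S: "S \<subseteq> V" "card S = s"
  shows "(\<Sum>X | X \<in> B \<and> S \<subseteq> X. F X) = (if S \<subseteq> K then 1 else 0)"
proof -
  have "card (K \<inter> S) \<le> s" using S finite_subset[OF S(1) finV] card_mono[of S "K \<inter> S"] by auto
  have kw: "k - card (K - S) = card (K \<inter> S)" "card (K - S) \<le> k"
    using finK cardK card_Diff_subset_Int[of K S] card_mono[of K "K \<inter> S"] by auto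
  have "(\<Sum>X | X \<in> B \<and> S \<subseteq> X. F X) = (\<Sum>i\<le>s. g i * bs i * real (card (K - S) choose i))"
    unfolding F_def by (rule sum_containing_comb[OF S]) simp
  also have "\<dots> = (\<Sum>i\<le>s. (-1) ^ i * (real (card (K - S) choose i) * real ((k - i) choose (s - i))))"
  proof (rule sum.cong[OF refl])
    fix i assume "i \<in> {..s}"
    then have "bs i \<noteq> 0" using bs_pos[of i] by simp
    then show "g i * bs i * real (card (K - S) choose i)
        = (-1) ^ i * (real (card (K - S) choose i) * real ((k - i) choose (s - i)))"
      by (simp add: g_def)
  qed
  also have "\<dots> = real (card (K \<inter> S) choose s)"
    using binomial_alternating[OF kw(2) sk] kw(1) by simp
  also have "\<dots> = (if S \<subseteq> K then 1 else 0)"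
  proof (cases "S \<subseteq> K")
    case True
    then show ?thesis using S by (simp add: Int_absorb1)
  next
    case False
    then have "K \<inter> S \<subset> S" by auto
    then have "card (K \<inter> S) < s" using S finite_subset[OF S(1) finV] psubset_card_mono by metis
    then show ?thesis using False by simp
  qed
  finally show ?thesis .
qed

text \<open>Averaging over the \<open>s\<close>-subsets between \<open>T\<close> and a block.\<close>

lemma sum_F_containing_small:
  assumes T: "T \<subseteq> K" "card T \<le> s"
  shows "(\<Sum>X | X \<in> B \<and> T \<subseteq> X. F X) = 1"
proof -
  define N where "N = (k - card T) choose (s - card T)"
  have N: "N > 0" unfolding N_def using sk by simp
  have fS: "finite {S. T \<subseteq> S \<and> S \<subseteq> V \<and> card S = s}"
    by (rule finite_subset[of _ "Pow V"]) (use finV in auto)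
  have "real N * (\<Sum>X | X \<in> B \<and> T \<subseteq> X. F X)
      = (\<Sum>X | X \<in> B \<and> T \<subseteq> X. \<Sum>S | T \<subseteq> S \<and> S \<subseteq> V \<and> card S = s. if S \<subseteq> X then F X else 0)"
    unfolding sum_distrib_left
  proof (rule sum.cong[OF refl])
    fix X assume "X \<in> {X. X \<in> B \<and> T \<subseteq> X}"
    then have X: "X \<subseteq> V" "card X = k" "T \<subseteq> X" "finite X"
      using block finite_block by auto
    have "{S. T \<subseteq> S \<and> S \<subseteq> V \<and> card S = s} \<inter> {S. S \<subseteq> X} = {S. T \<subseteq> S \<and> S \<subseteq> X \<and> card S = s}"
      using X by auto
    then show "real N * F X = (\<Sum>S | T \<subseteq> S \<and> S \<subseteq> V \<and> card S = s. if S \<subseteq> X then F X else 0)"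
      using card_between[OF X(4,3) T(2)] X fS by (simp add: sum.If_cases N_def)
  qed
  also have "\<dots> = (\<Sum>S | T \<subseteq> S \<and> S \<subseteq> V \<and> card S = s. \<Sum>X | X \<in> B \<and> T \<subseteq> X. if S \<subseteq> X then F X else 0)"
    by (rule sum.swap)
  also have "\<dots> = (\<Sum>S | T \<subseteq> S \<and> S \<subseteq> V \<and> card S = s. if S \<subseteq> K then 1 else 0)"
  proof (rule sum.cong[OF refl])
    fix S assume S: "S \<in> {S. T \<subseteq> S \<and> S \<subseteq> V \<and> card S = s}"
    have "{X. X \<in> B \<and> T \<subseteq> X} \<inter> {X. S \<subseteq> X} = {X. X \<in> B \<and> S \<subseteq> X}" using S by auto
    then have "(\<Sum>X | X \<in> B \<and> T \<subseteq> X. if S \<subseteq> X then F X else 0) = (\<Sum>X | X \<in> B \<and> S \<subseteq> X. F X)"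
      using finB by (simp add: sum.If_cases)
    then show "(\<Sum>X | X \<in> B \<and> T \<subseteq> X. if S \<subseteq> X then F X else 0) = (if S \<subseteq> K then 1 else 0)"
      using sum_F_containing S by simp
  qed
  also have "\<dots> = real N"
  proof -
    have "{S. T \<subseteq> S \<and> S \<subseteq> V \<and> card S = s} \<inter> {S. S \<subseteq> K} = {S. T \<subseteq> S \<and> S \<subseteq> K \<and> card S = s}"
      using KV by auto
    then show ?thesis
      using card_between[OF finK T] cardK fS by (simp add: sum.If_cases N_def)
  qed
  finally show ?thesis using N by simp
qed

text \<open>Against polynomials of degree at most s in \<open>card (K - X)\<close>, \<open>F\<close>
  acts like the indicator of \<open>K\<close>, because both have the same sum over the blocks
  through any subset of \<open>K\<close> with at most s points.\<close>

lemma sum_F_binomial: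
  assumes i: "i \<le> s"
  shows "(\<Sum>X\<in>B. F X * real (card (K - X) choose i)) = (if i = 0 then 1 else 0)"
proof -
  have ik: "i \<le> k" using i sk by simp
  have F_sum: "(\<Sum>X\<in>B. F X * real (card (K \<inter> X) choose j)) = real (k choose j)" if "j \<le> s" for j
  proof -
    have fT: "finite {T. T \<subseteq> K \<and> card T = j}"
      by (rule finite_subset[of _ "Pow K"]) (use finK in auto)
    have "(\<Sum>X\<in>B. F X * real (card (K \<inter> X) choose j))
        = (\<Sum>X\<in>B. \<Sum>T | T \<subseteq> K \<and> card T = j. if T \<subseteq> X then F X else 0)"
    proof (rule sum.cong[OF refl])
      fix X
      have "{T. T \<subseteq> K \<and> card T = j} \<inter> {T. T \<subseteq> X} = {T. T \<subseteq> K \<inter> X \<and> card T = j}" by auto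
      then show "F X * real (card (K \<inter> X) choose j)
          = (\<Sum>T | T \<subseteq> K \<and> card T = j. if T \<subseteq> X then F X else 0)"
        using n_subsets[of "K \<inter> X" j] finK fT by (simp add: sum.If_cases)
    qed
    also have "\<dots> = (\<Sum>T | T \<subseteq> K \<and> card T = j. \<Sum>X\<in>B. if T \<subseteq> X then F X else 0)"
      by (rule sum.swap)
    also have "\<dots> = (\<Sum>T | T \<subseteq> K \<and> card T = j. 1)"
    proof (rule sum.cong[OF refl])
      fix T assume "T \<in> {T. T \<subseteq> K \<and> card T = j}"
      then have "(\<Sum>X | X \<in> B \<and> T \<subseteq> X. F X) = 1"
        using that by (intro sum_F_containing_small) auto
      then show "(\<Sum>X\<in>B. if T \<subseteq> X then F X else 0) = 1"
        using finB by (simp add: sum.If_cases Collect_conj_eq)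
    qed
    finally show ?thesis using n_subsets[OF finK, of j] cardK by simp
  qed
  have card: "k - card (K \<inter> X) = card (K - X)" "card (K \<inter> X) \<le> k" for X
    using finK cardK card_Diff_subset_Int[of K X] card_mono[of K "K \<inter> X"] by auto
  have "(\<Sum>X\<in>B. F X * real (card (K - X) choose i))
      = (\<Sum>X\<in>B. \<Sum>j\<le>i. (-1) ^ j * real ((k - j) choose (i - j)) * (F X * real (card (K \<inter> X) choose j)))"
  proof (rule sum.cong[OF refl])
    fix X
    have "F X * real (card (K - X) choose i)
        = F X * (\<Sum>j\<le>i. (-1) ^ j * (real (card (K \<inter> X) choose j) * real ((k - j) choose (i - j))))"
      using binomial_alternating[OF card(2) ik, of X] card(1)[of X] by simp
    then show "F X * real (card (K - X) choose i)
        = (\<Sum>j\<le>i. (-1) ^ j * real ((k - j) choose (i - j)) * (F X * real (card (K \<inter> X) choose j)))"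
      by (simp add: sum_distrib_left mult_ac)
  qed
  also have "\<dots> = (\<Sum>j\<le>i. (-1) ^ j * real ((k - j) choose (i - j)) * (\<Sum>X\<in>B. F X * real (card (K \<inter> X) choose j)))"
    unfolding sum_distrib_left by (rule sum.swap)
  also have "\<dots> = (\<Sum>j\<le>i. (-1) ^ j * (real (k choose j) * real ((k - j) choose (i - j))))"
    using F_sum i by (intro sum.cong) auto
  also have "\<dots> = real ((k - k) choose i)"
    by (rule binomial_alternating) (use ik in auto)
  finally show ?thesis by simp
qed

text \<open>The values \<open>F X\<close> form a row of an idempotent matrix whose diagonal entries are \<open>1\<close> by
  tightness, so the other entries of the row vanish.\<close>

lemma F_eq_0:
  assumes "X \<in> B" "X \<noteq> K"
  shows "F X = 0"
proof -
  have g0: "g 0 = 1" using bs_0 bs_pos[of 0] by (simp add: g_def)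
  have "(\<Sum>X\<in>B. F X * F X) = (\<Sum>X\<in>B. \<Sum>i\<le>s. g i * (F X * real (card (K - X) choose i)))"
    by (subst (2) F_def) (simp add: sum_distrib_left mult_ac)
  also have "\<dots> = (\<Sum>i\<le>s. g i * (\<Sum>X\<in>B. F X * real (card (K - X) choose i)))"
    unfolding sum_distrib_left by (rule sum.swap)
  also have "\<dots> = (\<Sum>i\<le>s. if i = 0 then g i else 0)"
    by (intro sum.cong) (auto simp: sum_F_binomial)
  finally have "(\<Sum>X\<in>B. F X * F X) = 1" using g0 by simp
  moreover have "F K = 1"
  proof -
    have "F K = (\<Sum>i\<le>s. if i = 0 then g i else 0)"
      unfolding F_def by (intro sum.cong) auto
    then show ?thesis using g0 by simp
  qed
  ultimately have "(\<Sum>X\<in>B - {K}. F X * F X) = 0"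
    using finB K by (simp add: sum.remove[of B K])
  then have "F X * F X = 0"
    using finB assms by (subst (asm) sum_nonneg_eq_0_iff) auto
  then show ?thesis by simp
qed

definition Z :: "nat set" where "Z = (\<lambda>X. card (K - X)) ` (B - {K})"

lemma finZ: "finite Z"
  unfolding Z_def using finB by simp

lemma Z_pos: "z \<in> Z \<Longrightarrow> z > 0"
proof -
  assume "z \<in> Z"
  then obtain X where X: "X \<in> B" "X \<noteq> K" "z = card (K - X)" unfolding Z_def by blast
  have "\<not> K \<subseteq> X"
  proof
    assume "K \<subseteq> X"
    moreover have "finite X" "card X = card K" using X block finite_block cardK by auto
    ultimately show False using X card_subset_eq by metis
  qed
  then show "z > 0" using X finK by (simp add: card_gt_0_iff)
qed

text \<open>Test sets for \<open>card_Z_ge\<close>; there is room outside \<open>K\<close> because k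
  + s \<le> v.\<close>

lemma subset_with_intersection:
  assumes "t \<le> s"
  obtains S where "S \<subseteq> V" "card S = s" "card (K - S) = k - t" "S \<subseteq> K \<longleftrightarrow> t = s"
proof -
  obtain S1 where S1: "S1 \<subseteq> K" "card S1 = t"
    using obtain_subset_with_card_n[of t K] assms sk cardK by auto
  have "card (V - K) = v - k" using finK KV cardV cardK by (simp add: card_Diff_subset)
  then have "s - t \<le> card (V - K)" using kv by simp
  then obtain S2 where S2: "S2 \<subseteq> V - K" "card S2 = s - t"
    by (rule obtain_subset_with_card_n)
  have fin: "finite S1" "finite S2" using S1 S2 finK finV finite_subset by (blast, blast)
  have "card (S1 \<union> S2) = s" using S1 S2 fin assms by (subst card_Un_disjoint) auto
  moreover have "K - (S1 \<union> S2) = K - S1" using S2 by auto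
  then have "card (K - (S1 \<union> S2)) = k - t" using S1 fin cardK by (simp add: card_Diff_subset)
  moreover have "S1 \<union> S2 \<subseteq> K \<longleftrightarrow> t = s"
  proof
    assume "S1 \<union> S2 \<subseteq> K"
    then have "S2 = {}" using S2 by auto
    then show "t = s" using S2 assms by simp
  next
    assume "t = s"
    then have "S2 = {}" using S2 fin by simp
    then show "S1 \<union> S2 \<subseteq> K" using S1 by simp
  qed
  ultimately show ?thesis using that[of "S1 \<union> S2"] S1 S2 KV by auto
qed

text \<open>With fewer than s distances, the monic polynomial vanishing on them has degree below s.
  Summed over the blocks through S, it becomes a polynomial in \<open>card (K - S)\<close> of degree
  below s, with zeros at the s values k - t for t < s, where S is not inside \<open>K\<close>. So it
  is zero; but for S inside \<open>K\<close> the term of \<open>K\<close> survives and is not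
  zero.\<close>

lemma card_Z_ge: "s \<le> card Z"
proof (rule ccontr)
  assume "\<not> s \<le> card Z"
  then have n: "card Z < s" by simp
  obtain d :: "nat \<Rightarrow> int" where d:
    "\<And>z. (\<Prod>x\<in>Z. real z - real x) = (\<Sum>i\<le>card Z. of_int (d i) * fact i * real (z choose i))"
    using prod_falling_expansion[OF finZ] by blast
  define h where "h = (\<lambda>w. \<Sum>i\<le>card Z. of_int (d i) * fact i * bs i * real (w choose i))"
  have h: "h (k - t) = (if t = s then (\<Prod>x\<in>Z. - real x) else 0)" if t: "t \<le> s" for t
  proof -
    obtain S where S: "S \<subseteq> V" "card S = s" "card (K - S) = k - t" "S \<subseteq> K \<longleftrightarrow> t = s"
      by (rule subset_with_intersection[OF t])
    have "h (k - t) = (\<Sum>X | X \<in> B \<and> S \<subseteq> X. \<Prod>x\<in>Z. real (card (K - X)) - real x)"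
      unfolding h_def d using sum_containing_comb[OF S(1,2), of "card Z" "\<lambda>i. of_int (d i) * fact i"] n S(3)
      by simp
    also have "\<dots> = (\<Sum>X | X \<in> B \<and> S \<subseteq> X. if X = K then (\<Prod>x\<in>Z. - real x) else 0)"
    proof (rule sum.cong[OF refl])
      fix X assume X: "X \<in> {X. X \<in> B \<and> S \<subseteq> X}"
      show "(\<Prod>x\<in>Z. real (card (K - X)) - real x) = (if X = K then (\<Prod>x\<in>Z. - real x) else 0)"
      proof (cases "X = K")
        case False
        then have "card (K - X) \<in> Z" using X unfolding Z_def by auto
        then show ?thesis using False finZ by auto
      qed simp
    qed
    also have "\<dots> = (if t = s then (\<Prod>x\<in>Z. - real x) else 0)"
      using finB K S(4) by auto
    finally show ?thesis .
  qed
  have coeff: "of_int (d i) * fact i * bs i = 0" if "i \<le> card Z" for i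
  proof (rule binomial_sum_zero[of "(\<lambda>t. k - t) ` {..<s}" "card Z" "\<lambda>i. of_int (d i) * fact i * bs i"])
    have "inj_on (\<lambda>t. k - t) {..<s}" using sk by (auto simp: inj_on_def)
    then show "card Z < card ((\<lambda>t. k - t) ` {..<s})" using n by (simp add: card_image)
    show "(\<Sum>i\<le>card Z. of_int (d i) * fact i * bs i * real (z choose i)) = 0"
      if "z \<in> (\<lambda>t. k - t) ` {..<s}" for z
      using that h unfolding h_def by auto
  qed (use that in auto)
  have "(\<Prod>x\<in>Z. - real x) = h (k - s)" using h[of s] by simp
  also have "\<dots> = 0" unfolding h_def using coeff by (intro sum.neutral) auto
  finally show False using finZ Z_pos by auto
qed

text \<open>As a polynomial of degree s in the distance, \<open>F\<close> vanishes at s distances,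
  so it is a multiple of their monic product, whose coordinates are integers. Comparison with the
  leading coordinate eliminates the scalar.\<close>

lemma coefficient_integral:
  assumes "i \<le> s"
  obtains d :: int where "real ((k - i) choose (s - i)) * bs s * fact s = of_int d * fact i * bs i"
proof -
  obtain Y where Y: "Y \<subseteq> Z" "card Y = s"
    using obtain_subset_with_card_n[OF card_Z_ge] by auto
  have fY: "finite Y" using Y finZ finite_subset by blast
  obtain d :: "nat \<Rightarrow> int" where ds: "d s = 1" and d:
    "\<And>z. (\<Prod>x\<in>Y. real z - real x) = (\<Sum>i\<le>s. of_int (d i) * fact i * real (z choose i))"
    using prod_falling_expansion[OF fY] Y by auto
  \<comment> \<open>The difference of two polynomials with common zeros \<open>Y\<close> and equal
    leading coordinates; its degree is below s.\<close>
  define e where "e = (\<lambda>i. fact s * g i - g s * of_int (d i) * fact i)"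
  have es: "e s = 0" unfolding e_def ds by simp
  have "e i = 0"
  proof (cases "i = s")
    case False
    have "s > 0" using assms False by simp
    show ?thesis
    proof (rule binomial_sum_zero[OF fY, of "s - 1" e])
      show "s - 1 < card Y" using \<open>s > 0\<close> Y by simp
      show "i \<le> s - 1" using assms False by simp
      fix z assume z: "z \<in> Y"
      then obtain X where X: "X \<in> B" "X \<noteq> K" "z = card (K - X)" using Y unfolding Z_def by blast
      have "(\<Sum>i\<le>s. g i * real (z choose i)) = 0" using F_eq_0[OF X(1,2)] X(3) unfolding F_def by simp
      moreover have "(\<Sum>i\<le>s. of_int (d i) * fact i * real (z choose i)) = 0"
        unfolding d[symmetric] using z fY by auto
      moreover have "(\<Sum>i\<le>s. e i * real (z choose i)) = fact s * (\<Sum>i\<le>s. g i * real (z choose i))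
          - g s * (\<Sum>i\<le>s. of_int (d i) * fact i * real (z choose i))"
        unfolding e_def sum_distrib_left sum_subtractf[symmetric]
        by (intro sum.cong) (auto simp: algebra_simps)
      ultimately have "(\<Sum>i\<le>s. e i * real (z choose i)) = 0" by simp
      moreover have "{..s} = insert s {..s - 1}" using \<open>s > 0\<close> by auto
      ultimately show "(\<Sum>i\<le>s - 1. e i * real (z choose i)) = 0"
        using es \<open>s > 0\<close> by simp
    qed
  qed (use es in simp)
  then have "fact s * g i = g s * of_int (d i) * fact i" unfolding e_def by simp
  then have "real ((k - i) choose (s - i)) * bs s * fact s = of_int ((-1) ^ i * (-1) ^ s * d i) * fact i * bs i"
    using bs_pos[OF assms] bs_pos[of s]
    by (cases "even i"; cases "even s") (simp_all add: g_def field_simps)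
  then show ?thesis by (rule that)
qed

end

end

section \<open>Block counts and divisibility in tight designs\<close>

text \<open>The case v < 2 s is treated in the theorem itself: there the left side of the bound is
  at most 0.\<close>

locale nontrivial_tight =
  fixes s v k lam :: nat and V :: "'a set" and B :: "'a set set"
  assumes tightD: "tight_design s v k lam V B"
    and nontrivial: "nontrivial_design (2 * s) v k lam V B"
    and sv: "2 * s \<le> v"
begin

text \<open>Normalised so that each block count below is \<open>mu\<close> times the number of
  k-subsets of \<open>V\<close> with the same property.\<close>

definition mu :: real where "mu = real lam / real ((v - 2 * s) choose (k - 2 * s))"

lemma finV: "finite V" and cardV: "card V = v" and lam: "0 < lam"
  and block: "X \<in> B \<Longrightarrow> X \<subseteq> V \<and> card X = k"
  and level: "T \<subseteq> V \<Longrightarrow> card T = 2 * s \<Longrightarrow> card {X \<in> B. T \<subseteq> X} = lam"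
  using tightD unfolding tight_design_def design_def by auto

lemma finX: "X \<in> B \<Longrightarrow> finite X"
  using block finV finite_subset by metis

lemma finB: "finite B"
  by (rule finite_subset[of _ "Pow V"]) (use block finV in auto)

lemma k_bounds: "2 * s \<le> k" "k \<le> v"
proof -
  obtain T where T: "T \<subseteq> V" "card T = 2 * s"
    using obtain_subset_with_card_n[of "2 * s" V] sv cardV by auto
  then have "{X \<in> B. T \<subseteq> X} \<noteq> {}" using level[OF T] lam by (metis card.empty less_nat_zero_code)
  then obtain X where X: "X \<in> B" "T \<subseteq> X" by blast
  show "2 * s \<le> k" using card_mono[OF finX[OF X(1)] X(2)] T block[OF X(1)] by simp
  show "k \<le> v" using card_mono[OF finV] block[OF X(1)] cardV by auto
qed

lemma mu_pos: "mu > 0"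
  unfolding mu_def using lam k_bounds by simp

text \<open>Downward from size 2 s, by counting the pairs of a block X through \<open>J\<close> and
  a point of X outside \<open>J\<close>.\<close>

lemma count_containing:
  assumes "J \<subseteq> V" "card J \<le> 2 * s"
  shows "real (card {X \<in> B. J \<subseteq> X}) = mu * real ((v - card J) choose (k - card J))"
  using assms
proof (induction "2 * s - card J" arbitrary: J)
  case 0
  then have "card J = 2 * s" by simp
  then show ?case using level[OF 0(2)] k_bounds by (simp add: mu_def)
next
  case (Suc n)
  define j where "j = card J"
  have j: "j < 2 * s" using Suc.hyps by (simp add: j_def)
  have fJ: "finite J" using Suc.prems finV finite_subset by blast
  have "(k - j) * card {X \<in> B. J \<subseteq> X} = (\<Sum>X\<in>{X \<in> B. J \<subseteq> X}. card (X - J))"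
  proof -
    have "card (X - J) = k - j" if "X \<in> {X \<in> B. J \<subseteq> X}" for X
      using that block fJ by (simp add: card_Diff_subset j_def)
    then show ?thesis by simp
  qed
  also have "\<dots> = (\<Sum>X\<in>{X \<in> B. J \<subseteq> X}. \<Sum>x\<in>V - J. if x \<in> X then 1 else 0)"
  proof (rule sum.cong[OF refl])
    fix X assume "X \<in> {X \<in> B. J \<subseteq> X}"
    then have "X - J = (V - J) \<inter> {x. x \<in> X}" using block by blast
    then show "card (X - J) = (\<Sum>x\<in>V - J. if x \<in> X then 1 else 0)"
      using finV by (simp add: sum.If_cases)
  qed
  also have "\<dots> = (\<Sum>x\<in>V - J. \<Sum>X\<in>{X \<in> B. J \<subseteq> X}. if x \<in> X then 1 else 0)"
    by (rule sum.swap)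
  also have "\<dots> = (\<Sum>x\<in>V - J. card {X \<in> B. insert x J \<subseteq> X})"
  proof (rule sum.cong[OF refl])
    fix x
    have "{X \<in> B. J \<subseteq> X} \<inter> {X. x \<in> X} = {X \<in> B. insert x J \<subseteq> X}" by auto
    then show "(\<Sum>X\<in>{X \<in> B. J \<subseteq> X}. if x \<in> X then 1 else 0) = card {X \<in> B. insert x J \<subseteq> X}"
      using finB by (simp add: sum.If_cases)
  qed
  finally have "real (k - j) * real (card {X \<in> B. J \<subseteq> X}) = (\<Sum>x\<in>V - J. real (card {X \<in> B. insert x J \<subseteq> X}))"
    by (metis (no_types, lifting) of_nat_mult of_nat_sum sum.cong)
  also have "\<dots> = (\<Sum>x\<in>V - J. mu * real ((v - Suc j) choose (k - Suc j)))"
  proof (rule sum.cong[OF refl])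
    fix x assume x: "x \<in> V - J"
    then have c: "card (insert x J) = Suc j" using fJ by (simp add: j_def)
    have "real (card {X \<in> B. insert x J \<subseteq> X}) = mu * real ((v - card (insert x J)) choose (k - card (insert x J)))"
      using Suc.hyps(2) Suc.prems x c j j_def by (intro Suc.hyps(1)) auto
    then show "real (card {X \<in> B. insert x J \<subseteq> X}) = mu * real ((v - Suc j) choose (k - Suc j))"
      unfolding c .
  qed
  also have "\<dots> = mu * (real (v - j) * real ((v - Suc j) choose (k - Suc j)))"
    using Suc.prems fJ finV cardV by (simp add: card_Diff_subset j_def)
  also have "real (v - j) * real ((v - Suc j) choose (k - Suc j)) = real (k - j) * real ((v - j) choose (k - j))"
  proof -
    have "v - j = Suc (v - Suc j)" "k - j = Suc (k - Suc j)" using j k_bounds by auto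
    then have "(v - j) * ((v - Suc j) choose (k - Suc j)) = (k - j) * ((v - j) choose (k - j))"
      using Suc_times_binomial[of "k - Suc j" "v - Suc j"] by (simp add: mult.commute)
    then show ?thesis by (metis of_nat_mult)
  qed
  finally have "real (k - j) * real (card {X \<in> B. J \<subseteq> X}) = real (k - j) * (mu * real ((v - j) choose (k - j)))"
    by simp
  moreover have "real (k - j) \<noteq> 0" using j k_bounds by simp
  ultimately show ?case unfolding j_def by simp
qed

text \<open>Dropping a point x from the avoided set splits the blocks by whether they contain x, so
  the counts obey Pascal's rule.\<close>

lemma count_avoiding:
  assumes "J \<subseteq> V" "I \<subseteq> V" "J \<inter> I = {}" "card J + card I \<le> 2 * s"
  shows "real (card {X \<in> B. J \<subseteq> X \<and> X \<inter> I = {}}) = mu * real ((v - card J - card I) choose (k - card J))"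
proof -
  have "finite I" using assms finV finite_subset by blast
  then show ?thesis using assms
  proof (induction I arbitrary: J rule: finite_induct)
    case empty
    then show ?case using count_containing by simp
  next
    case (insert x I)
    have fJ: "finite J" using insert.prems finV finite_subset by blast
    define j where "j = card J"
    define i where "i = card I"
    have cI: "card (insert x I) = Suc i" using insert by (simp add: i_def)
    have cJ: "card (insert x J) = Suc j" using insert fJ by (simp add: j_def)
    have ij: "Suc (i + j) \<le> 2 * s" using insert.prems cI by (simp add: j_def)
    have "{X \<in> B. J \<subseteq> X \<and> X \<inter> I = {}}
        = {X \<in> B. J \<subseteq> X \<and> X \<inter> insert x I = {}} \<union> {X \<in> B. insert x J \<subseteq> X \<and> X \<inter> I = {}}"
      by auto
    then have "card {X \<in> B. J \<subseteq> X \<and> X \<inter> I = {}}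
        = card {X \<in> B. J \<subseteq> X \<and> X \<inter> insert x I = {}} + card {X \<in> B. insert x J \<subseteq> X \<and> X \<inter> I = {}}"
      using finB by (simp only:) (rule card_Un_disjoint, auto)
    moreover have "real (card {X \<in> B. J \<subseteq> X \<and> X \<inter> I = {}}) = mu * real ((v - j - i) choose (k - j))"
      unfolding i_def j_def using insert.prems cI ij by (intro insert.IH) (auto simp: i_def j_def)
    moreover have "real (card {X \<in> B. insert x J \<subseteq> X \<and> X \<inter> I = {}}) = mu * real ((v - Suc j - i) choose (k - Suc j))"
      unfolding cJ[symmetric] i_def using insert.prems insert.hyps cI ij cJ
      by (intro insert.IH) (auto simp: i_def j_def)
    moreover have "real ((v - j - i) choose (k - j)) = real ((v - j - Suc i) choose (k - j)) + real ((v - Suc j - i) choose (k - Suc j))"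
    proof -
      have "v - j - i = Suc (v - j - Suc i)" "k - j = Suc (k - Suc j)" "v - Suc j - i = v - j - Suc i"
        using ij k_bounds sv by auto
      then show ?thesis by simp
    qed
    ultimately show ?case unfolding cI j_def[symmetric]
      by (simp add: algebra_simps)
  qed
qed

text \<open>If a \<open>k\<close>-subset or its complement had at most \<open>2 * s\<close> points, then the number of blocks equal
  to it would not depend on the subset, so all \<open>k\<close>-subsets would be blocks.\<close>

lemma strict_bounds: "2 * s < k" "k + 2 * s < v"
proof -
  obtain X0 where X0: "X0 \<subseteq> V" "card X0 = k" "X0 \<notin> B"
    using nontrivial unfolding nontrivial_design_def design_def by blast
  have fX0: "finite X0" using X0 finV finite_subset by blast
  show "2 * s < k"
  proof (rule ccontr)
    assume "\<not> 2 * s < k"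
    then have "card X0 = 2 * s" using X0 k_bounds by simp
    then have "{X \<in> B. X0 \<subseteq> X} \<noteq> {}" using level[of X0] lam X0 by (metis card.empty less_nat_zero_code)
    then obtain X where X: "X \<in> B" "X0 \<subseteq> X" by blast
    then have "X0 = X" using card_subset_eq[OF finX[OF X(1)] X(2)] X0 block[OF X(1)] by simp
    then show False using X X0 by simp
  qed
  show "k + 2 * s < v"
  proof (rule ccontr)
    assume neg: "\<not> k + 2 * s < v"
    have cI: "card (V - X0) = v - k" using X0 fX0 cardV by (simp add: card_Diff_subset)
    have "real (card {X \<in> B. X \<inter> (V - X0) = {}}) = mu * real ((v - card (V - X0)) choose k)"
      using count_avoiding[of "{}" "V - X0"] cI neg by simp
    also have "\<dots> > 0" using mu_pos cI k_bounds by simp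
    finally have "{X \<in> B. X \<inter> (V - X0) = {}} \<noteq> {}" by (auto simp: card_gt_0_iff)
    then obtain X where X: "X \<in> B" "X \<inter> (V - X0) = {}" by blast
    then have "X \<subseteq> X0" using block by blast
    then have "X = X0" using card_subset_eq[OF fX0] X0 block[OF X(1)] by simp
    then show False using X X0 by simp
  qed
qed

lemma mu_tight: "mu * real (v choose k) = real (v choose s)"
proof -
  have "{X \<in> B. {} \<subseteq> X} = B" by auto
  then have "real (card B) = mu * real (v choose k)"
    using count_containing[of "{}"] by simp
  then show ?thesis using tightD unfolding tight_design_def by simp
qed

sublocale tight_blocks s v k mu V B
proof
  show "real (card {X \<in> B. J \<subseteq> X \<and> X \<inter> I = {}}) = mu * real ((v - s - card I) choose (k - s))"
    if "J \<subseteq> V" "I \<subseteq> V" "J \<inter> I = {}" "card J = s" "card I \<le> s" for J I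
    using count_avoiding[of J I] that by simp
qed (use finV cardV strict_bounds mu_pos block mu_tight in auto)

text \<open>The quotient is the integer of \<open>coefficient_integral\<close> at index s - j:
  \<open>bs s\<close> and \<open>bs (s - j)\<close> are \<open>mu\<close> times binomial
  coefficients, and their factorials reduce to these products.\<close>

lemma coefficient_dvd:
  assumes j: "j \<le> s"
  shows "\<Prod>{Suc (v - 2 * s)..v - 2 * s + j} dvd
    (s choose j) * (\<Prod>{Suc (k - s)..k - s + j} * \<Prod>{Suc (v - k - s)..v - k - s + j})"
proof -
  define a where "a = k - s"
  define b where "b = v - k - s"
  define m where "m = a + b"
  have m: "v - 2 * s = m" "m - a = b" "m + j - a = b + j"
    using strict_bounds by (auto simp: a_def b_def m_def)
  have "B \<noteq> {}"
  proof
    assume "B = {}"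
    then have "real (v choose s) = 0" using tightD unfolding tight_design_def by simp
    then show False using sv by simp
  qed
  then obtain K where K: "K \<in> B" by blast
  obtain d :: int where d: "real ((k - (s - j)) choose (s - (s - j))) * bs s * fact s = of_int d * fact (s - j) * bs (s - j)"
    using coefficient_integral[OF K, of "s - j"] by auto
  have e: "k - (s - j) = a + j" "s - (s - j) = j" "v - s - s = m" "v - s - (s - j) = m + j" "k - s = a"
    using j strict_bounds by (auto simp: a_def b_def m_def)
  have bs: "bs s = mu * real (m choose a)" "bs (s - j) = mu * real ((m + j) choose a)"
    unfolding bs_def e by auto
  have "mu * (real ((a + j) choose j) * real (m choose a) * fact s)
      = mu * (of_int d * fact (s - j) * real ((m + j) choose a))"
    using d unfolding e bs by (simp add: mult_ac)
  then have 1: "real ((a + j) choose j) * real (m choose a) * fact s = of_int d * fact (s - j) * real ((m + j) choose a)"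
    using mu_pos by simp
  have c1: "real (m choose a) = fact m / (fact a * fact b)"
    using m by (subst binomial_fact) (auto simp: m_def)
  have c2: "real ((m + j) choose a) = fact (m + j) / (fact a * fact (b + j))"
    using m by (subst binomial_fact) (auto simp: m_def)
  have c3: "(fact s :: real) = real (s choose j) * fact j * fact (s - j)"
    using binomial_fact[OF j, where 'a = real] by simp
  have Pm: "(fact (m + j) :: real) = fact m * real (\<Prod>{Suc m..m + j})"
    using fact_eq_fact_times[of m "m + j"] by (metis le_add1 of_nat_fact of_nat_mult)
  have Pb: "(fact (b + j) :: real) = fact b * real (\<Prod>{Suc b..b + j})"
    using fact_eq_fact_times[of b "b + j"] by (metis le_add1 of_nat_fact of_nat_mult)
  have Pa: "real (\<Prod>{Suc a..a + j}) = fact j * real ((a + j) choose j)"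
    unfolding interval_prod by simp
  have "real ((s choose j) * (\<Prod>{Suc a..a + j} * \<Prod>{Suc b..b + j})) = of_int d * real (\<Prod>{Suc m..m + j})"
  proof -
    have nz: "real (\<Prod>{Suc m..m + j}) \<noteq> 0" "real (\<Prod>{Suc b..b + j}) \<noteq> 0"
      using interval_prod_pos[of m "m + j"] interval_prod_pos[of b "b + j"] by simp_all
    have "real ((a + j) choose j) * real (s choose j) * fact j = of_int d * real (\<Prod>{Suc m..m + j}) / real (\<Prod>{Suc b..b + j})"
      using 1 nz unfolding c1 c2 c3 Pm Pb by (simp add: field_simps)
    then show ?thesis using nz unfolding of_nat_mult Pa by (simp add: field_simps)
  qed
  then have "int ((s choose j) * (\<Prod>{Suc a..a + j} * \<Prod>{Suc b..b + j})) = d * int (\<Prod>{Suc m..m + j})"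
    by (metis of_int_eq_iff of_int_mult of_int_of_nat_eq)
  then have "int (\<Prod>{Suc m..m + j}) dvd int ((s choose j) * (\<Prod>{Suc a..a + j} * \<Prod>{Suc b..b + j}))"
    by simp
  then have "\<Prod>{Suc m..m + j} dvd (s choose j) * (\<Prod>{Suc a..a + j} * \<Prod>{Suc b..b + j})"
    by (simp only: int_dvd_int_iff)
  then show ?thesis unfolding m(1) a_def b_def .
qed

text \<open>The quotient is the number of blocks through 2 s - i + 1 points. The factor s! arises
  when \<open>mu\<close> is eliminated by \<open>mu_tight\<close>.\<close>

lemma level_dvd:
  assumes i: "1 \<le> i" "i \<le> s"
  shows "fact s * \<Prod>{v - 2 * s + i..v - 2 * s + s} dvd \<Prod>{k - s + i - s..k - s + s}"
proof -
  define t where "t = 2 * s - i + 1"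
  have t: "t \<le> 2 * s" "t \<le> k" "t \<le> v" "s \<le> t" using i strict_bounds by (auto simp: t_def)
  obtain T where T: "T \<subseteq> V" "card T = t"
    using obtain_subset_with_card_n[of t V] t cardV by auto
  define l where "l = card {X \<in> B. T \<subseteq> X}"
  have l: "real l = mu * real ((v - t) choose (k - t))"
    unfolding l_def using count_containing[OF T(1)] T t by simp
  have i1: "{v - 2 * s + i..v - 2 * s + s} = {Suc (v - t)..v - s}"
    and i2: "{k - s + i - s..k - s + s} = {Suc (k - t)..k}"
    using i strict_bounds by (auto simp: t_def)
  have P1: "(fact (v - s) :: real) = fact (v - t) * real (\<Prod>{Suc (v - t)..v - s})"
    using fact_eq_fact_times[of "v - t" "v - s"] t by (metis diff_le_mono2 of_nat_fact of_nat_mult)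
  have P2: "(fact k :: real) = fact (k - t) * real (\<Prod>{Suc (k - t)..k})"
    using fact_eq_fact_times[of "k - t" k] by (metis diff_le_self of_nat_fact of_nat_mult)
  have "v - t - (k - t) = v - k" using t by simp
  then have c: "real ((v - t) choose (k - t)) = fact (v - t) / (fact (k - t) * fact (v - k))"
    using k_bounds by (subst binomial_fact) auto
  have mu: "mu = (fact v / (fact s * fact (v - s))) * (fact k * fact (v - k)) / fact v"
    using mu_tight k_bounds sv by (simp add: binomial_fact field_simps)
  have "real (l * (fact s * \<Prod>{Suc (v - t)..v - s})) = real (\<Prod>{Suc (k - t)..k})"
  proof -
    have nz: "real (\<Prod>{Suc (v - t)..v - s}) \<noteq> 0"
      using interval_prod_pos[of "v - t" "v - s"] by simp
    show ?thesis unfolding of_nat_mult l c mu P1 P2 of_nat_fact using nz by (simp add: field_simps)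
  qed
  then have "\<Prod>{Suc (k - t)..k} = l * (fact s * \<Prod>{Suc (v - t)..v - s})"
    by (metis of_nat_eq_iff)
  then show ?thesis unfolding i1 i2 by simp
qed

lemma tight_parameters:
  assumes "3 \<le> q" "2 * q \<le> s"
  shows "tight_parameters s q (k - s) (v - k - s) (v - 2 * s)"
proof
  show "v - 2 * s = k - s + (v - k - s)" "s < k - s" "s < v - k - s"
    using strict_bounds by auto
qed (use assms coefficient_dvd level_dvd in auto)

end

section \<open>The main inequality\<close>

text \<open>The exponential of the first bracket in \<open>kappa\<close>, where \<open>q = r / 2\<close> and \<open>n = s - r + 1\<close>.\<close>

definition main_term :: "nat \<Rightarrow> nat \<Rightarrow> real" where
  "main_term q n = fact (2 * n + q) * fact (n + 2 * q - 1) * 2 ^ (n - 1)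
     / (fact (2 * n + 2 * q) * fact n * real (n + q))"

section \<open>Lower bounds for \<open>main_term\<close>\<close>

lemma fact_pred: "0 < n \<Longrightarrow> n - 1 = m \<Longrightarrow> (fact n :: real) = real n * fact m"
  by (subst fact_reduce) auto

lemma le_eight_fraction: "0 < D \<Longrightarrow> g * D \<le> 8 * X \<Longrightarrow> g \<le> 8 * (X / D)" for D X g :: real
  by (simp add: pos_le_divide_eq)

lemma main_term_Suc:
  assumes "0 < n" "0 < q"
  shows "main_term q (Suc n) = main_term q n
    * (2 * real ((2 * n + q + 1) * (2 * n + q + 2) * (n + 2 * q) * (n + q))
       / real ((2 * n + 2 * q + 1) * (2 * n + 2 * q + 2) * (n + 1) * (n + q + 1)))"
proof -
  have 1: "(fact (2 * Suc n + q) :: real) = real (2 * n + q + 2) * (real (2 * n + q + 1) * fact (2 * n + q))"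
    using fact_pred[of "2 * n + q + 2" "2 * n + q + 1"] fact_pred[of "2 * n + q + 1" "2 * n + q"] by simp
  have 2: "(fact (2 * Suc n + 2 * q) :: real)
      = real (2 * n + 2 * q + 2) * (real (2 * n + 2 * q + 1) * fact (2 * n + 2 * q))"
    using fact_pred[of "2 * n + 2 * q + 2" "2 * n + 2 * q + 1"] fact_pred[of "2 * n + 2 * q + 1" "2 * n + 2 * q"]
    by simp
  have 3: "(fact (Suc n + 2 * q - 1) :: real) = real (n + 2 * q) * fact (n + 2 * q - 1)"
    using fact_pred[of "n + 2 * q" "n + 2 * q - 1"] assms by simp
  have 4: "(2 :: real) ^ (Suc n - 1) = 2 * 2 ^ (n - 1)"
    using assms by (cases n) auto
  have 5: "(fact (Suc n) :: real) = real (n + 1) * fact n" by simp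
  have frac: "(c2 * (c1 * A)) * (c3 * X) * (2 * Y) / ((d2 * (d1 * C)) * (d3 * D) * d4)
      = A * X * Y / (C * D * c4) * (2 * (c1 * c2 * c3 * c4) / (d1 * d2 * d3 * d4))"
    if "c4 \<noteq> 0" for A X Y C D c1 c2 c3 c4 d1 d2 d3 d4 :: real
    using that by (simp add: mult_ac)
  have "real (n + q) \<noteq> 0" using assms by simp
  from frac[OF this] show ?thesis
    unfolding main_term_def 1 2 3 4 5 of_nat_mult by (simp only: add_Suc Suc_eq_plus1 add_ac)
qed

text \<open>The case s = 2 q. The constant 8 is what \<open>central_binomial_bound\<close> leaves of
  4^q, as 4^q = 8 * 4^(q - 1) / 2.\<close>

lemma main_term_1:
  assumes "3 \<le> q"
  shows "fact (q - 2) \<le> 8 * main_term q 1"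
proof -
  \<comment> \<open>With q = x + 3 the claim reduces to a polynomial inequality that holds
    coefficient by coefficient.\<close>
  obtain x where q: "q = x + 3" using assms le_Suc_ex by (metis add.commute)
  define u :: real where "u = real x"
  define f :: real where "f = fact (x + 1)"
  have f0: "f > 0" "u \<ge> 0" by (simp_all add: f_def u_def)
  have f1: "(fact (x + 5) :: real) = (u + 5) * ((u + 4) * ((u + 3) * ((u + 2) * f)))"
    using fact_pred[of "x + 5" "x + 4"] fact_pred[of "x + 4" "x + 3"] fact_pred[of "x + 3" "x + 2"]
      fact_pred[of "x + 2" "x + 1"] by (simp add: f_def u_def)
  have f2: "(fact (2 * x + 8) :: real) = (2 * u + 8) * ((2 * u + 7) * fact (2 * x + 6))"
    using fact_pred[of "2 * x + 8" "2 * x + 7"] fact_pred[of "2 * x + 7" "2 * x + 6"] by (simp add: u_def)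
  have e: "2 * 1 + q = x + 5" "2 * 1 + 2 * q = 2 * x + 8" "1 + 2 * q - 1 = 2 * x + 6" "1 + q = x + 4"
    "q - 2 = x + 1"
    unfolding q by simp_all
  have "X * F * 2 ^ (1 - 1) / (c * (d * F) * fact 1 * w) = X / (c * d * w)"
    if "F \<noteq> 0" for X F c d w :: real
    using that by simp
  then have "main_term q 1 = (u + 5) * ((u + 4) * ((u + 3) * ((u + 2) * f))) / ((2 * u + 8) * (2 * u + 7) * real (x + 4))"
    unfolding main_term_def e f1 f2 by (simp only: fact_nonzero not_False_eq_True)
  then have "main_term q 1 = (u + 5) * ((u + 4) * ((u + 3) * ((u + 2) * f))) / ((2 * u + 8) * (2 * u + 7) * (u + 4))"
    by (simp add: u_def)
  moreover have "(2 * u + 8) * (2 * u + 7) * (u + 4) \<le> 8 * ((u + 5) * ((u + 4) * ((u + 3) * (u + 2))))"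
  proof -
    have "2 * (2 * u + 7) * (u + 4) \<le> 8 * ((u + 5) * ((u + 3) * (u + 2)))"
      using f0 by (simp add: algebra_simps)
    then have "(u + 4) * (2 * (2 * u + 7) * (u + 4)) \<le> (u + 4) * (8 * ((u + 5) * ((u + 3) * (u + 2))))"
      using f0 by (intro mult_left_mono) auto
    then show ?thesis by (simp add: algebra_simps)
  qed
  then have "f * ((2 * u + 8) * (2 * u + 7) * (u + 4)) \<le> f * (8 * ((u + 5) * ((u + 4) * ((u + 3) * (u + 2)))))"
    using f0 by (intro mult_left_mono) auto
  then have "f * ((2 * u + 8) * (2 * u + 7) * (u + 4)) \<le> 8 * ((u + 5) * ((u + 4) * ((u + 3) * ((u + 2) * f))))"
    by (simp only: mult_ac)
  moreover have "(2 * u + 8) * (2 * u + 7) * (u + 4) > 0" using f0 by (intro mult_pos_pos) auto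
  moreover have "fact (q - 2) = f" unfolding f_def q by simp
  ultimately show ?thesis by (simp only: le_eight_fraction)
qed

text \<open>For n \<ge> 2 there is room for the factor s = n + 2 q - 1 that an exceptional prime may
  require. From n to n + 1 the left side grows by (n + 2 q) / (n + 2 q - 1), and
  \<open>main_term\<close> by at least as much.\<close>

lemma main_term_ge:
  assumes "3 \<le> q" "2 \<le> n"
  shows "fact (q - 2) * real (n + 2 * q - 1) \<le> 8 * main_term q n"
  using assms(2)
proof (induction n rule: dec_induct)
  case base
  obtain x where q: "q = x + 3" using assms le_Suc_ex by (metis add.commute)
  define u :: real where "u = real x"
  define f :: real where "f = fact (x + 1)"
  have f0: "f > 0" "u \<ge> 0" by (simp_all add: f_def u_def)
  have f1: "(fact (x + 7) :: real) = (u + 7) * ((u + 6) * ((u + 5) * ((u + 4) * ((u + 3) * ((u + 2) * f)))))"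
    using fact_pred[of "x + 7" "x + 6"] fact_pred[of "x + 6" "x + 5"]
      fact_pred[of "x + 5" "x + 4"] fact_pred[of "x + 4" "x + 3"] fact_pred[of "x + 3" "x + 2"]
      fact_pred[of "x + 2" "x + 1"] by (simp add: f_def u_def)
  have f2: "(fact (2 * x + 10) :: real) = (2 * u + 10) * ((2 * u + 9) * ((2 * u + 8) * fact (2 * x + 7)))"
    using fact_pred[of "2 * x + 10" "2 * x + 9"] fact_pred[of "2 * x + 9" "2 * x + 8"]
      fact_pred[of "2 * x + 8" "2 * x + 7"] by (simp add: u_def)
  have e: "2 * 2 + q = x + 7" "2 * 2 + 2 * q = 2 * x + 10" "2 + 2 * q - 1 = 2 * x + 7" "2 + q = x + 5"
    "q - 2 = x + 1"
    unfolding q by simp_all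
  have "X * F * 2 ^ (2 - 1) / (c * (d * (h * F)) * fact 2 * w) = X / (c * d * h * w)"
    if "F \<noteq> 0" for X F c d h w :: real
    using that by (simp add: fact_2)
  then have "main_term q 2 = (u + 7) * ((u + 6) * ((u + 5) * ((u + 4) * ((u + 3) * ((u + 2) * f)))))
      / ((2 * u + 10) * (2 * u + 9) * (2 * u + 8) * real (x + 5))"
    unfolding main_term_def e f1 f2 by (simp only: fact_nonzero not_False_eq_True)
  then have mt: "main_term q 2 = (u + 7) * ((u + 6) * ((u + 5) * ((u + 4) * ((u + 3) * ((u + 2) * f)))))
      / ((2 * u + 10) * (2 * u + 9) * (2 * u + 8) * (u + 5))"
    by (simp add: u_def)
  have "(2 * u + 10) * (2 * u + 9) * (2 * u + 8) * (u + 5) * (2 * u + 7)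
      \<le> 8 * ((u + 7) * ((u + 6) * ((u + 5) * ((u + 4) * ((u + 3) * (u + 2))))))"
  proof -
    have "4 * (2 * u + 9) * (u + 5) * (2 * u + 7) \<le> 8 * ((u + 7) * ((u + 6) * ((u + 3) * (u + 2))))"
      using f0 by (simp add: algebra_simps)
    then have "((u + 5) * (u + 4)) * (4 * (2 * u + 9) * (u + 5) * (2 * u + 7))
        \<le> ((u + 5) * (u + 4)) * (8 * ((u + 7) * ((u + 6) * ((u + 3) * (u + 2)))))"
      using f0 by (intro mult_left_mono) auto
    then show ?thesis by (simp add: algebra_simps)
  qed
  then have "f * ((2 * u + 10) * (2 * u + 9) * (2 * u + 8) * (u + 5) * (2 * u + 7))
      \<le> f * (8 * ((u + 7) * ((u + 6) * ((u + 5) * ((u + 4) * ((u + 3) * (u + 2)))))))"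
    using f0 by (intro mult_left_mono) auto
  then have "f * (2 * u + 7) * ((2 * u + 10) * (2 * u + 9) * (2 * u + 8) * (u + 5))
      \<le> 8 * ((u + 7) * ((u + 6) * ((u + 5) * ((u + 4) * ((u + 3) * ((u + 2) * f))))))"
    by (simp only: mult_ac)
  moreover have "(2 * u + 10) * (2 * u + 9) * (2 * u + 8) * (u + 5) > 0" using f0 by (intro mult_pos_pos) auto
  moreover have "fact (q - 2) * real (2 + 2 * q - 1) = f * (2 * u + 7)" unfolding e f_def u_def by simp
  ultimately show ?case unfolding mt by (simp only: le_eight_fraction)
next
  case (step n)
  define N where "N = (2 * n + q + 1) * (2 * n + q + 2) * (n + 2 * q) * (n + q)"
  define D where "D = (2 * n + 2 * q + 1) * (2 * n + 2 * q + 2) * (n + 1) * (n + q + 1)"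
  have "D > 0" unfolding D_def by simp
  then have D: "real D > 0" by simp
  obtain x where q: "q = x + 3" using assms le_Suc_ex by (metis add.commute)
  obtain y where n: "n = y + 2" using step le_Suc_ex by (metis add.commute)
  \<comment> \<open>\<open>N\<close> contains the factor n + 2 q, so only the other factors have to
    be compared, in two pairs.\<close>
  have "(n + 2 * q) * D \<le> 2 * N * (n + 2 * q - 1)"
  proof -
    have "n + 2 * q - 1 = y + 2 * x + 7" unfolding q n by simp
    moreover have "D \<le> 2 * ((2 * n + q + 1) * (2 * n + q + 2) * (n + q)) * (y + 2 * x + 7)"
    proof -
      have "(2 * n + 2 * q + 1) * (n + 1) \<le> (2 * n + q + 2) * (n + q)"
        unfolding q n by (simp add: algebra_simps)
      moreover have "(n + q + 1) * (n + q + 1) \<le> (2 * n + q + 1) * (y + 2 * x + 7)"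
        unfolding q n by (simp add: algebra_simps)
      ultimately have le: "((2 * n + 2 * q + 1) * (n + 1)) * ((n + q + 1) * (n + q + 1))
          \<le> ((2 * n + q + 2) * (n + q)) * ((2 * n + q + 1) * (y + 2 * x + 7))"
        by (rule mult_le_mono)
      have eq: "D = 2 * (((2 * n + 2 * q + 1) * (n + 1)) * ((n + q + 1) * (n + q + 1)))"
      proof -
        have "2 * n + 2 * q + 2 = 2 * (n + q + 1)" by simp
        then show ?thesis unfolding D_def by (simp only: mult_ac)
      qed
      have "D \<le> 2 * (((2 * n + q + 2) * (n + q)) * ((2 * n + q + 1) * (y + 2 * x + 7)))"
        unfolding eq using le by (rule mult_le_mono2)
      then show ?thesis by (simp only: mult_ac)
    qed
    then have "(n + 2 * q) * D \<le> (n + 2 * q) * (2 * ((2 * n + q + 1) * (2 * n + q + 2) * (n + q)) * (y + 2 * x + 7))"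
      by (rule mult_left_mono) simp
    ultimately show ?thesis unfolding N_def by (simp only: mult_ac)
  qed
  then have ratio: "real (n + 2 * q) * real D \<le> 2 * real N * real (n + 2 * q - 1)"
    by (metis of_nat_le_iff of_nat_mult of_nat_numeral)
  have "fact (q - 2) * real (n + 2 * q) \<le> fact (q - 2) * (2 * real N * real (n + 2 * q - 1) / real D)"
    using ratio D by (intro mult_left_mono) (auto simp: field_simps)
  also have "\<dots> = fact (q - 2) * real (n + 2 * q - 1) * (2 * real N / real D)"
    by simp
  also have "\<dots> \<le> 8 * main_term q n * (2 * real N / real D)"
    using step.IH by (rule mult_right_mono) simp
  also have "\<dots> = 8 * main_term q (Suc n)"
    using step assms by (subst main_term_Suc) (auto simp: N_def D_def)
  finally show ?case by simp
qed

text \<open>The coefficient occurs twice in its row, at q and at q - 2.\<close>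

lemma central_binomial_bound:
  assumes "2 \<le> q"
  shows "2 * ((2 * q - 2) choose q) \<le> 4 ^ (q - 1)"
proof -
  have "(2 * q - 2) choose q = (2 * q - 2) choose (q - 2)"
    using assms by (subst binomial_symmetric) auto
  then have "2 * ((2 * q - 2) choose q) = (\<Sum>k\<in>{q, q - 2}. (2 * q - 2) choose k)"
    using assms by simp
  also have "\<dots> \<le> (\<Sum>k\<le>2 * q - 2. (2 * q - 2) choose k)"
    using assms by (intro sum_mono2) auto
  also have "\<dots> = 2 ^ (2 * (q - 1))"
    unfolding choose_row_sum using assms by (simp add: diff_mult_distrib2)
  finally show ?thesis by (simp add: power_mult)
qed

text \<open>The left side collects the leftovers of the primes p \<le> beta from
  \<open>val_den_crude\<close> and the exceptional factor, at most s. The 4^q is the gain made in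
  \<open>num_le_den\<close>.\<close>

lemma main_term_bound:
  assumes q: "3 \<le> q" and s: "2 * q \<le> s"
  shows "real (((2 * q - 2) choose q) * fact (q - 2)) * (if 2 * q < s then real s else 1)
    \<le> 4 ^ q * main_term q (s - 2 * q + 1)"
proof -
  define n where "n = s - 2 * q + 1"
  have sn: "s = n + 2 * q - 1" using s by (simp add: n_def)
  have *: "fact (q - 2) * (if 2 * q < s then real s else 1) \<le> 8 * main_term q n"
  proof (cases "2 * q < s")
    case True
    then have "2 \<le> n" using sn by simp
    then show ?thesis using main_term_ge[OF q] True sn by simp
  next
    case False
    then have "n = 1" using s n_def by simp
    then show ?thesis using main_term_1[OF q] False by simp
  qed
  have "real ((2 * q - 2) choose q) * 2 \<le> 4 ^ (q - 1)"
  proof -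
    have "real (2 * ((2 * q - 2) choose q)) \<le> real (4 ^ (q - 1))"
      using central_binomial_bound[of q] q by (intro of_nat_mono) auto
    then show ?thesis by simp
  qed
  then have "real ((2 * q - 2) choose q) * 2 * (fact (q - 2) * (if 2 * q < s then real s else 1))
      \<le> 4 ^ (q - 1) * (8 * main_term q n)"
    using * by (rule mult_mono) auto
  moreover have "(4 :: real) ^ q = 4 * 4 ^ (q - 1)" using q by (cases q) auto
  ultimately show ?thesis unfolding n_def[symmetric] by (simp add: mult_ac)
qed

section \<open>Logarithms as sums over primes\<close>

lemma ln_eq_sum_multiplicity:
  assumes "0 < n" "finite P" "prime_factors n \<subseteq> P" "\<And>p. p \<in> P \<Longrightarrow> prime p"
  shows "ln (real n) = (\<Sum>p\<in>P. real (multiplicity p n) * ln (real p))"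
proof -
  have "n = (\<Prod>p\<in>prime_factors n. p ^ multiplicity p n)"
    using prod_prime_factors[of n] assms by simp
  also have "\<dots> = (\<Prod>p\<in>P. p ^ multiplicity p n)"
    using assms by (intro prod.mono_neutral_left) (auto simp: prime_factors_multiplicity)
  finally have "real n = (\<Prod>p\<in>P. real p ^ multiplicity p n)"
    by (metis (no_types, lifting) of_nat_power of_nat_prod prod.cong)
  also have "ln \<dots> = (\<Sum>p\<in>P. ln (real p ^ multiplicity p n))"
    using assms(2,4) prime_gt_0_nat by (intro ln_prod) auto
  also have "\<dots> = (\<Sum>p\<in>P. real (multiplicity p n) * ln (real p))"
    using assms(4) prime_gt_0_nat by (intro sum.cong) (auto simp: ln_realpow)
  finally show ?thesis .
qed

lemma sum_multiplicity_le_ln: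
  assumes "0 < n" "finite A" "\<And>p. p \<in> A \<Longrightarrow> prime p"
  shows "(\<Sum>p\<in>A. real (multiplicity p n) * ln (real p)) \<le> ln (real n)"
proof -
  have "(\<Sum>p\<in>A. real (multiplicity p n) * ln (real p))
      \<le> (\<Sum>p\<in>A \<union> prime_factors n. real (multiplicity p n) * ln (real p))"
  proof (intro sum_mono2)
    fix p assume "p \<in> A \<union> prime_factors n - A"
    then have "1 \<le> p" by (intro prime_ge_1_nat) auto
    then show "0 \<le> real (multiplicity p n) * ln (real p)" by simp
  qed (use assms in auto)
  also have "\<dots> = ln (real n)"
    using assms by (intro ln_eq_sum_multiplicity[symmetric]) auto
  finally show ?thesis .
qed

lemma val_F_tilde:
  assumes p: "prime p"
  shows "multiplicity p (fact s :: nat) + multiplicity p (fact r :: nat) + 2 * multiplicity p (ell (s - 1))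
    + 2 * multiplicity p (ell (s - 2)) \<le> multiplicity p (F_tilde s r)"
proof -
  have "multiplicity p (fact s :: nat) + multiplicity p (fact r :: nat) + 2 * multiplicity p (ell (s - 1))
      + 2 * multiplicity p (ell (s - 2)) = multiplicity p (fact s * fact r * (ell (s - 1))\<^sup>2 * (ell (s - 2))\<^sup>2)"
    using ell_pos by (simp add: val_mult[OF p] power2_eq_square)
  also have "\<dots> \<le> multiplicity p (F_tilde s r)"
    unfolding F_tilde_def using ell_pos by (intro val_dvd[OF p]) auto
  finally show ?thesis .
qed

section \<open>From the local bounds to the inequality\<close>

context tight_parameters
begin

text \<open>By AM-GM, 4 (a + l) (b + l) \<le> (m + 2 l)^2. The q squares are bounded by the long
  range of \<open>den\<close> times one additional m + 1. This uses up one of the q - 1 factors of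
  the short range and leaves q - 2, whence r - 4 in \<open>psi\<close>.\<close>

lemma num_le_den: "4 ^ q * num * (m + 1) ^ (q - 2) \<le> den"
proof -
  have "4 ^ q * num = (\<Prod>l<q. (2 * (a + l)) * (2 * (b + l)))"
  proof -
    have "\<Prod>{x..<x + q} = (\<Prod>l<q. x + l)" for x
      by (intro prod.reindex_bij_witness[where i = "\<lambda>l. x + l" and j = "\<lambda>z. z - x"]) auto
    moreover have "(\<Prod>l<q. (2 * (a + l)) * (2 * (b + l))) = (\<Prod>l<q. 4 * ((a + l) * (b + l)))"
      by (intro prod.cong) (auto simp: algebra_simps)
    ultimately show ?thesis
      unfolding num_def by (simp add: prod.distrib)
  qed
  also have "\<dots> \<le> (\<Prod>l<q. (m + 2 * l)\<^sup>2)"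
  proof (rule prod_mono, safe)
    fix l
    have "int (2 * (a + l) * (2 * (b + l))) \<le> int ((m + 2 * l)\<^sup>2)"
    proof -
      have "int ((m + 2 * l)\<^sup>2) - int (2 * (a + l) * (2 * (b + l))) = (int a - int b)\<^sup>2"
        unfolding m by (simp add: power2_eq_square algebra_simps)
      then show ?thesis by (metis diff_ge_0_iff_ge zero_le_power2)
    qed
    then show "2 * (a + l) * (2 * (b + l)) \<le> (m + 2 * l)\<^sup>2" by linarith
  qed
  also have "(\<Prod>l<n. (m + 2 * l)\<^sup>2) \<le> (m + 1) * \<Prod>{Suc m..m + (2 * n - 1)}" if "0 < n" for n
    using that
  proof (induction n rule: nat_induct_non_zero)
    case 1
    show ?case by (simp add: power2_eq_square mult_le_mono)
  next
    case (Suc n)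
    have "{Suc m..m + (2 * Suc n - 1)} = {Suc m..m + (2 * n - 1)} \<union> {m + 2 * n, m + 2 * n + 1}"
      using Suc by auto
    also have "\<Prod>\<dots> = \<Prod>{Suc m..m + (2 * n - 1)} * ((m + 2 * n) * (m + 2 * n + 1))"
      using Suc by (subst prod.union_disjoint) auto
    finally have "(m + 1) * \<Prod>{Suc m..m + (2 * Suc n - 1)}
        = ((m + 1) * \<Prod>{Suc m..m + (2 * n - 1)}) * ((m + 2 * n) * (m + 2 * n + 1))"
      by (simp only: mult_ac)
    moreover have "(m + 2 * n)\<^sup>2 \<le> (m + 2 * n) * (m + 2 * n + 1)"
      by (simp add: power2_eq_square)
    ultimately show ?case
      unfolding prod.lessThan_Suc using Suc.IH by (simp only: mult_le_mono)
  qed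
  finally have "4 ^ q * num \<le> (m + 1) * \<Prod>{Suc m..m + (2 * q - 1)}" using q3 by simp
  then have "4 ^ q * num * (m + 1) ^ (q - 2) \<le> (m + 1) * \<Prod>{Suc m..m + (2 * q - 1)} * (m + 1) ^ (q - 2)"
    by (rule mult_le_mono1)
  also have "\<dots> = (m + 1) ^ (q - 1) * \<Prod>{Suc m..m + (2 * q - 1)}"
  proof -
    have "q - 1 = Suc (q - 2)" using q3 by simp
    then show ?thesis by (simp only: power_Suc mult_ac)
  qed
  also have "(m + 1) ^ (q - 1) \<le> \<Prod>{Suc m..m + (q - 1)}"
  proof -
    have "(\<Prod>x\<in>{Suc m..m + (q - 1)}. m + 1) \<le> \<Prod>{Suc m..m + (q - 1)}"
      by (rule prod_mono) auto
    then show ?thesis by simp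
  qed
  finally show ?thesis unfolding den_def by (simp add: mult_le_mono1)
qed

lemma ln_den_le:
  assumes bs: "beta \<le> real s"
  shows "ln (real den) - ln (real num) \<le> 2 * real (prime_pi beta) * ln (3 / 2 * real (m + 1))
    + ln (real (((2 * q - 2) choose q) * fact (q - 2)))
    + (\<Sum>p \<in> {p. prime p \<and> beta < real p \<and> p \<le> s}. real (multiplicity p (F_tilde s (2 * q))) * ln (real p))
    + ln (if 2 * q < s then real s else 1)"
proof -
  define w where "w = (\<lambda>p. (real (multiplicity p den) - real (multiplicity p num)) * ln (real p))"
  define N where "N = ((2 * q - 2) choose q) * fact (q - 2)"
  define A where "A = {p. prime p \<and> real p \<le> beta}"
  define C where "C = {p. prime p \<and> beta < real p \<and> p \<le> s}"
  define P where "P = A \<union> C \<union> (prime_factors den \<union> prime_factors num)"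
  have N: "N > 0" unfolding N_def using q3 by auto
  have As: "p \<le> s" if "p \<in> A" for p using that bs by (simp add: A_def)
  have fA: "finite A" by (rule finite_subset[of _ "{..s}"]) (use As in auto)
  have fC: "finite C" by (rule finite_subset[of _ "{..s}"]) (auto simp: C_def)
  have P: "finite P" "\<And>p. p \<in> P \<Longrightarrow> prime p"
    using fA fC by (auto simp: P_def A_def C_def)
  have "ln (real den) - ln (real num) = (\<Sum>p\<in>P. w p)"
  proof -
    have "prime_factors den \<subseteq> P" "prime_factors num \<subseteq> P" unfolding P_def by auto
    then show ?thesis
      using ln_eq_sum_multiplicity[OF den_pos P(1) _ P(2)] ln_eq_sum_multiplicity[OF num_pos P(1) _ P(2)]
      by (simp add: w_def sum_subtractf left_diff_distrib)
  qed
  also have "\<dots> \<le> (\<Sum>p\<in>A \<union> C. w p)"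
  proof -
    have "(\<Sum>p\<in>P. w p) = (\<Sum>p\<in>P - (A \<union> C). w p) + (\<Sum>p\<in>A \<union> C. w p)"
      using P by (intro sum.subset_diff) (auto simp: P_def)
    moreover have "w p \<le> 0" if "p \<in> P - (A \<union> C)" for p
    proof -
      have p: "prime p" "s < p" using that P(2)[of p] by (auto simp: A_def C_def)
      then show ?thesis
        using val_den_le_large[OF p] prime_ge_1_nat[OF p(1)] unfolding w_def
        by (intro mult_nonpos_nonneg) auto
    qed
    then have "(\<Sum>p\<in>P - (A \<union> C). w p) \<le> 0" by (intro sum_nonpos) auto
    ultimately show ?thesis by simp
  qed
  also have "\<dots> = (\<Sum>p\<in>A. w p) + (\<Sum>p\<in>C. w p)"
    using fA fC by (intro sum.union_disjoint) (auto simp: A_def C_def)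
  also have "(\<Sum>p\<in>A. w p) \<le> 2 * real (prime_pi beta) * ln (3 / 2 * real (m + 1)) + ln (real N)"
  proof -
    have "w p \<le> 2 * ln (3 / 2 * real (m + 1)) + real (multiplicity p N) * ln (real p)" if pA: "p \<in> A" for p
    proof -
      have p: "prime p" using pA by (simp add: A_def)
      have p1: "real p \<ge> 1" using prime_ge_1_nat[OF p] by simp
      define E where "E = Max ((\<lambda>i. multiplicity p (m + i)) ` {1..2 * q - 1})"
      have "E \<in> (\<lambda>i. multiplicity p (m + i)) ` {1..2 * q - 1}"
        unfolding E_def using q3 by (intro Max_in) auto
      then obtain i where i: "i \<in> {1..2 * q - 1}" "E = multiplicity p (m + i)" by blast
      have "p ^ E \<le> m + i" unfolding i(2) using i by (intro pow_val_le[OF p]) auto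
      then have "2 * p ^ E \<le> 2 * (m + i)" by (rule mult_le_mono2)
      \<comment> \<open>The origin of 3/2: here i < s and m > 2 s.\<close>
      also have "\<dots> \<le> 3 * (m + 1)" using i qs m sa sb by auto
      finally have "2 * p ^ E \<le> 3 * (m + 1)" .
      then have "real (2 * p ^ E) \<le> real (3 * (m + 1))" by (rule of_nat_mono)
      then have "real p ^ E \<le> 3 / 2 * real (m + 1)" by simp
      then have "ln (real p ^ E) \<le> ln (3 / 2 * real (m + 1))"
        using p1 by (subst ln_le_cancel_iff) auto
      then have E: "real E * ln (real p) \<le> ln (3 / 2 * real (m + 1))"
        using p1 by (simp add: ln_realpow)
      have "multiplicity p den \<le> multiplicity p num + 2 * E + multiplicity p ((2 * q - 2) choose q)
          + multiplicity p (fact (q - 2) :: nat)"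
        by (rule val_den_crude[OF p]) (simp add: E_def)
      moreover have "multiplicity p N = multiplicity p ((2 * q - 2) choose q) + multiplicity p (fact (q - 2) :: nat)"
        unfolding N_def using q3 by (intro val_mult[OF p]) auto
      ultimately have "real (multiplicity p den) - real (multiplicity p num) \<le> 2 * real E + real (multiplicity p N)"
        by simp
      then have "w p \<le> (2 * real E + real (multiplicity p N)) * ln (real p)"
        unfolding w_def using p1 by (intro mult_right_mono) auto
      then show ?thesis using E by (simp add: algebra_simps)
    qed
    then have "(\<Sum>p\<in>A. w p) \<le> (\<Sum>p\<in>A. 2 * ln (3 / 2 * real (m + 1)) + real (multiplicity p N) * ln (real p))"
      by (rule sum_mono)
    also have "\<dots> = 2 * real (card A) * ln (3 / 2 * real (m + 1)) + (\<Sum>p\<in>A. real (multiplicity p N) * ln (real p))"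
      by (simp add: sum.distrib)
    also have "(\<Sum>p\<in>A. real (multiplicity p N) * ln (real p)) \<le> ln (real N)"
      by (rule sum_multiplicity_le_ln[OF N fA]) (simp add: A_def)
    finally show ?thesis by (simp add: prime_pi_def A_def)
  qed
  also have "(\<Sum>p\<in>C. w p) \<le> (\<Sum>p\<in>C. real (multiplicity p (F_tilde s (2 * q))) * ln (real p))
      + ln (if 2 * q < s then real s else 1)"
  proof -
    define D where "D = (\<lambda>p. if s \<le> p + 1 \<and> 2 * q < s then ln (real p) else 0)"
    have "w p \<le> real (multiplicity p (F_tilde s (2 * q))) * ln (real p) + D p" if pC: "p \<in> C" for p
    proof -
      have p: "prime p" "p \<le> s" using pC by (auto simp: C_def)
      have p1: "real p \<ge> 1" using prime_ge_1_nat[OF p(1)] by simp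
      have "multiplicity p den \<le> multiplicity p num + multiplicity p (F_tilde s (2 * q))
          + (if s \<le> p + 1 \<and> 2 * q < s then 1 else 0)"
        using val_den_le_small[OF p] val_F_tilde[OF p(1), of s "2 * q"] by linarith
      then have "real (multiplicity p den) - real (multiplicity p num)
          \<le> real (multiplicity p (F_tilde s (2 * q))) + (if s \<le> p + 1 \<and> 2 * q < s then 1 else 0)"
        by auto
      then have "w p \<le> (real (multiplicity p (F_tilde s (2 * q))) + (if s \<le> p + 1 \<and> 2 * q < s then 1 else 0)) * ln (real p)"
        unfolding w_def using p1 by (intro mult_right_mono) auto
      moreover have "(if s \<le> p + 1 \<and> 2 * q < s then 1 else 0) * ln (real p) = D p"
        by (simp add: D_def)
      ultimately show ?thesis by (simp only: distrib_right)
    qed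
    then have "(\<Sum>p\<in>C. w p) \<le> (\<Sum>p\<in>C. real (multiplicity p (F_tilde s (2 * q))) * ln (real p) + D p)"
      by (rule sum_mono)
    \<comment> \<open>One of s - 1 and s is even and greater than 2, so at most one prime is
      exceptional, and it contributes at most ln s.\<close>
    moreover have "(\<Sum>p\<in>C. D p) \<le> ln (if 2 * q < s then real s else 1)"
    proof (cases "2 * q < s \<and> (\<exists>p\<in>C. s \<le> p + 1)")
      case True
      then obtain p0 where p0: "p0 \<in> C" "s \<le> p0 + 1" by blast
      have "D p = 0" if "p \<in> C - {p0}" for p
      proof -
        have "prime p" "prime p0" "p \<le> s" "p0 \<le> s" "p \<noteq> p0" using that p0 by (auto simp: C_def)
        moreover have "odd x" if "prime x" "s \<le> x + 1" for x
          using that q3 qs prime_odd_nat[of x] by linarith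
        ultimately have "\<not> s \<le> p + 1"
          using p0(2) by (metis Suc_eq_plus1 dvd_add_right_iff even_Suc le_Suc_eq le_antisym)
        then show ?thesis by (simp add: D_def)
      qed
      then have "(\<Sum>p\<in>C. D p) = (\<Sum>p\<in>{p0}. D p)"
        using p0 fC by (intro sum.mono_neutral_right) auto
      also have "\<dots> \<le> ln (real s)"
        using p0 prime_gt_0_nat[of p0] by (auto simp: D_def C_def)
      finally show ?thesis using True by simp
    next
      case False
      then have "(\<Sum>p\<in>C. D p) = 0" by (intro sum.neutral) (auto simp: D_def)
      then show ?thesis using q3 qs by auto
    qed
    ultimately show ?thesis by (simp add: sum.distrib)
  qed
  finally show ?thesis unfolding N_def C_def by linarith
qed

text \<open>The terms ln (4^q) of \<open>num_le_den\<close> and \<open>main_term_bound\<close>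
  cancel. What remains has exponent q - 2 - 2 pi(beta), and twice this inequality is the
  claim.\<close>

lemma kappa_bound:
  assumes bs: "beta \<le> real s"
  shows "psi beta s (2 * q) * ln (real (m + 1)) \<le> kappa beta s (2 * q)"
proof -
  define S where "S = (\<Sum>p \<in> {p. prime p \<and> beta < real p \<and> p \<le> s}.
    real (multiplicity p (F_tilde s (2 * q))) * ln (real p))"
  define T where "T = main_term q (s - 2 * q + 1)"
  define N where "N = ((2 * q - 2) choose q) * fact (q - 2)"
  define c where "c = real (prime_pi beta)"
  define x where "x = ln (real (m + 1))"
  have N: "N > 0" unfolding N_def using q3 by auto
  have s0: "s > 0" using q3 qs by simp
  have "real (4 ^ q * num * (m + 1) ^ (q - 2)) \<le> real den"
    using num_le_den by (rule of_nat_mono)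
  then have "ln (4 ^ q * real num * real (m + 1) ^ (q - 2)) \<le> ln (real den)"
    using num_pos den_pos by (subst ln_le_cancel_iff) (auto intro!: mult_pos_pos)
  moreover have "ln (4 ^ q * real num * real (m + 1) ^ (q - 2)) = ln (4 ^ q) + ln (real num) + (real q - 2) * x"
    using num_pos q3 unfolding x_def
    by (simp add: ln_mult ln_realpow of_nat_diff del: of_nat_Suc of_nat_add)
  moreover have "ln (real den) - ln (real num) \<le> 2 * c * ln (3 / 2 * real (m + 1)) + ln (real N) + S
      + ln (if 2 * q < s then real s else 1)"
    using ln_den_le[OF bs] unfolding c_def N_def S_def .
  moreover have "ln (3 / 2 * real (m + 1)) = ln (3 / 2) + x"
    unfolding x_def by (subst ln_mult) auto
  moreover have "ln (real N) + ln (if 2 * q < s then real s else 1) \<le> ln (4 ^ q) + ln T"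
  proof -
    have "ln (real N * (if 2 * q < s then real s else 1)) \<le> ln (4 ^ q * T)"
    proof (subst ln_le_cancel_iff)
      show "real N * (if 2 * q < s then real s else 1) \<le> 4 ^ q * T"
        unfolding N_def T_def using q3 qs by (rule main_term_bound)
      show "0 < real N * (if 2 * q < s then real s else 1)" using N s0 by auto
      show "0 < 4 ^ q * T" unfolding T_def main_term_def using q3 by auto
    qed
    moreover have "T > 0" unfolding T_def main_term_def using q3 by auto
    ultimately show ?thesis using N s0 by (simp add: ln_mult split: if_splits)
  qed
  ultimately have le: "(real q - 2 - 2 * c) * x \<le> ln T + S + 2 * ln (3 / 2) * c"
    by (simp add: algebra_simps)
  have "kappa beta s (2 * q) = 2 * (ln T + S + 2 * ln (3 / 2) * c)"
  proof -
    define n where "n = s - 2 * q + 1"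
    have e: "2 * s - 3 * (2 * q) div 2 + 2 = 2 * n + q" "2 * s - 2 * q + 2 = 2 * n + 2 * q"
      "s - 2 * q + 1 = n" "s - 2 * q div 2 + 1 = n + q" "s - 2 * q = n - 1" "s = n + 2 * q - 1"
      using qs by (auto simp: n_def)
    define Q where "Q = fact (2 * n + q) * fact s / (fact (2 * n + 2 * q) * fact n * real (n + q))"
    have "T = Q * 2 ^ (n - 1)"
      unfolding T_def main_term_def Q_def e(3) e(6)[symmetric] by simp
    moreover have "Q > 0" unfolding Q_def using q3 by auto
    ultimately have lnT: "ln T = ln Q + real (n - 1) * ln 2"
      by (simp add: ln_mult ln_realpow)
    have "kappa beta s (2 * q) = 2 * (ln Q + real (n - 1) * ln 2) + 2 * S + 4 * ln (3 / 2) * c"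
      unfolding kappa_def e(1-4) unfolding e(5) Q_def S_def c_def ..
    then show ?thesis unfolding lnT by (simp add: algebra_simps)
  qed
  moreover have "psi beta s (2 * q) * x = 2 * ((real q - 2 - 2 * c) * x)"
    unfolding psi_def c_def by (simp add: algebra_simps)
  moreover have "2 * ((real q - 2 - 2 * c) * x) \<le> 2 * (ln T + S + 2 * ln (3 / 2) * c)"
    using le by simp
  ultimately have "psi beta s (2 * q) * x \<le> kappa beta s (2 * q)"
    by (simp only:)
  then show ?thesis unfolding x_def .
qed

end

theorem theorem4p2:
  fixes s r v k lam :: nat and b :: real and V :: "'a set" and B :: "'a set set"
  assumes "even r" and "6 \<le> r" and "r \<le> s"
    and "b \<le> real s"
    and "psi b s r > 0"
    and "tight_design s v k lam V B"
    and "nontrivial_design (2 * s) v k lam V B"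
  shows "real v - 2 * real s + 1 \<le> exp (kappa b s r / psi b s r)"
proof (cases "2 * s \<le> v")
  case False
  then have "real v - 2 * real s + 1 \<le> 0" by simp
  then show ?thesis by (meson exp_ge_zero order.trans)
next
  case True
  interpret nontrivial_tight s v k lam V B
    using assms True by unfold_locales
  obtain q where q: "r = 2 * q" using \<open>even r\<close> by blast
  interpret tight_parameters s q "k - s" "v - k - s" "v - 2 * s"
    using assms q by (intro tight_parameters) auto
  define M where "M = real (v - 2 * s + 1)"
  have M: "real v - 2 * real s + 1 = M" "M > 0" using True by (auto simp: M_def)
  have "ln M \<le> kappa b s r / psi b s r"
    using kappa_bound[OF \<open>b \<le> real s\<close>] \<open>psi b s r > 0\<close>
    by (simp add: M_def q pos_le_divide_eq mult.commute)
  then have "exp (ln M) \<le> exp (kappa b s r / psi b s r)" by simp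
  then show ?thesis using M by simp
qed

end
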